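(* Let $X$ be a Lévy-type process on $\mathbb R^d$ (conservative and normal, with locally bounded and finely continuous differential characteristics) with symbol $q$. Let $x\in\mathbb R^d$, $\delta'>0$ and $R'>0$ be such that Condition (A$_x$) holds: for all $\Delta>0$ the function $(y,\xi)\mapsto\Re q(y,\xi)$ is jointly continuous on $B_{\delta'}(x)\times B_\Delta(0)$ and, for every $R\in(0,R')$, $$\lim_{t\downarrow0}\ \sup_{(y,\xi)\in B_{\delta'}(x)\times B_\Delta(0)}\left|\frac{1-\Re\,\mathbb E^y e^{i(X_t^\sigma-y)'\xi}}{t}-\Re q(y,\xi)\right|=0,$$ where $\sigma=\sigma^y_{B_R(y)}$ is the first exit time of $X$ (started at $y$) from $B_R(y)$. If $\beta_{loc}^x>0$ and $0<\lambda<\beta_{loc}^x$, then for any $T>0$, $$V^\lambda(X;[0,T])=+\infty\quad\mathbb P^x\text{-a.s.}$$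
   Context: $X=(\Omega,\mathcal F,(\mathcal F_t)_{t\ge0},(X_t)_{t\ge0},\mathbb P^x)_{x\in\mathbb R^d}$ is a time-homogeneous Markov process with state space $\mathbb R^d$. Normal means $\mathbb P^x(X_0=x)=1$ for all $x$; conservative means $\mathbb P^x(X_t\in\mathbb R^d)=1$ for all $t\ge0$, $x\in\mathbb R^d$. A Lévy-type process is a Hunt process (strong Markov, càdlàg, quasi-left-continuous) that is a semimartingale under every $\mathbb P^x$, with semimartingale characteristics (relative to a cut-off function $\chi$) of the form $B_t=\int_0^t\ell(X_s)\,ds$, $C_t=\int_0^tQ(X_s)\,ds$, $\nu(\omega;ds,dy)=N(X_s(\omega),dy)\,ds$, where $\ell(x)\in\mathbb R^d$, $Q(x)$ is a positive semi-definite matrix, and $N$ is a Borel transition kernel with $N(x,\{0\})=0$. Here $\chi:\mathbb R^d\to\mathbb R$ is measurable with $\mathbf 1_{B_r(0)}\le\chi\le\mathbf 1_{B_{2r}(0)}$ for some $r>0$, and $B_r(x)$ is the closed ball of radius $r$ centred at $x$. The differential characteristics are $\ell$, $Q$ and $n:=\int_{y\ne0}(1\wedge\|y\|^2)\,N(\cdot,dy)$. A function $f$ on $\mathbb R^d$ is finely continuous if $f\circ X$ is $\mathbb P^x$-a.s. right continuous for every $x$. Symbol: $q(x,\xi):=-\lim_{t\downarrow0}\mathbb E^x\frac{e^{i(X_t^\sigma-x)'\xi}-1}{t}$, where $\sigma$ is the first exit time of $X$ from a compact neighbourhood of $x$, $X^\sigma_t=X_{t\wedge\sigma}$, and the limit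 is required not to depend on the neighbourhood. For a Lévy-type process with locally bounded and finely continuous differential characteristics the symbol exists and equals $$q(x,\xi)=-i\ell(x)'\xi+\tfrac12\xi'Q(x)\xi-\int_{y\ne0}\big(e^{iy'\xi}-1-iy'\xi\,\chi(y)\big)N(x,dy).$$ Spot index: $\beta^y:=\inf\{\delta>0:\lim_{\|\xi\|\to\infty}\|\xi\|^{-\delta}\Re q(y,\xi)=0\}$. Local index: $\beta_{loc}^x:=\sup_{R>0}\inf_{y\in B_R(x)}\beta^y$. $V^p(g;[a,b]):=\sup\sum_{j=1}^n\|g(t_j)-g(t_{j-1})\|^p$, the supremum over all finite partitions $a=t_0<t_1<\dots<t_n=b$ (strong $p$-variation, $p>0$). *)

theory Defs
  imports "HOL-Probability.Probability"
begin

section \<open>Paths\<close>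

definition cadlag :: "(real \<Rightarrow> 'b::topological_space) \<Rightarrow> bool" where
  "cadlag f \<longleftrightarrow> (\<forall>t\<ge>0. (f \<longlongrightarrow> f t) (at_right t)) \<and> (\<forall>t>0. \<exists>l. (f \<longlongrightarrow> l) (at_left t))"

definition jump :: "(real \<Rightarrow> 'b::real_normed_vector) \<Rightarrow> real \<Rightarrow> 'b" where
  "jump f t = f t - Lim (at_left t) f"

definition p_variation :: "real \<Rightarrow> (real \<Rightarrow> 'b::real_normed_vector) \<Rightarrow> real \<Rightarrow> real \<Rightarrow> ennreal" where
  "p_variation p g a b =
    (SUP (n, t) \<in> {(n::nat, t). t 0 = a \<and> t n = b \<and> (\<forall>j<n. t j < t (Suc j))}.
      \<Sum>j=1..n. ennreal (norm (g (t j) - g (t (j - 1))) powr p))"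

text \<open>The value is \<open>\<top>\<close> if the path never leaves \<open>K\<close>.\<close>

definition exit_time :: "'b set \<Rightarrow> (real \<Rightarrow> 'b) \<Rightarrow> ennreal" where
  "exit_time K f = (INF t \<in> {t. 0 \<le> t \<and> f t \<notin> K}. ennreal t)"


section \<open>Filtrations and processes under a fixed probability measure\<close>

text \<open>
  Filtrations and processes are indexed by \<open>real\<close>; only the indices \<open>t \<ge> 0\<close> matter.
  Random times take values in \<open>[0, \<infinity>]\<close>. To use the library's stopping times and
  \<open>\<sigma>\<close>-algebras \<open>\<F>\<^sub>\<tau>\<close>, a filtration is closed at \<open>\<infinity>\<close> by the ambient
  \<open>\<sigma>\<close>-algebra of \<open>M\<close>.
\<close>

definition closed_filtration :: "'w measure \<Rightarrow> (real \<Rightarrow> 'w measure) \<Rightarrow> ennreal \<Rightarrow> 'w measure" where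
  "closed_filtration M F t = (if t = \<top> then M else F (enn2real t))"

definition stopped :: "('w \<Rightarrow> ennreal) \<Rightarrow> (real \<Rightarrow> 'w \<Rightarrow> 'b) \<Rightarrow> real \<Rightarrow> 'w \<Rightarrow> 'b" where
  "stopped \<tau> Y t \<omega> = Y (enn2real (min (ennreal t) (\<tau> \<omega>))) \<omega>"

definition adapted :: "(real \<Rightarrow> 'w measure) \<Rightarrow> (real \<Rightarrow> 'w \<Rightarrow> real) \<Rightarrow> bool" where
  "adapted F Y \<longleftrightarrow> (\<forall>t\<ge>0. Y t \<in> borel_measurable (F t))"

definition predictable_sigma :: "'w measure \<Rightarrow> (real \<Rightarrow> 'w measure) \<Rightarrow> ('w \<times> real) measure" where
  "predictable_sigma P F = sigma (space P \<times> {0..})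
     ({A \<times> {0} | A. A \<in> sets (F 0)} \<union> {A \<times> {s<..t} | A s t. 0 \<le> s \<and> s < t \<and> A \<in> sets (F s)})"

definition predictable :: "'w measure \<Rightarrow> (real \<Rightarrow> 'w measure) \<Rightarrow> (real \<Rightarrow> 'w \<Rightarrow> real) \<Rightarrow> bool" where
  "predictable P F Y \<longleftrightarrow> (\<lambda>(\<omega>, t). Y t \<omega>) \<in> borel_measurable (predictable_sigma P F)"

definition martingale :: "'w measure \<Rightarrow> (real \<Rightarrow> 'w measure) \<Rightarrow> (real \<Rightarrow> 'w \<Rightarrow> real) \<Rightarrow> bool" where
  "martingale P F Y \<longleftrightarrow> adapted F Y \<and> (\<forall>t\<ge>0. integrable P (Y t)) \<and>
     (\<forall>s t. 0 \<le> s \<longrightarrow> s \<le> t \<longrightarrow> (AE \<omega> in P. real_cond_exp P (F s) (Y t) \<omega> = Y s \<omega>))"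

definition local_martingale :: "'w measure \<Rightarrow> (real \<Rightarrow> 'w measure) \<Rightarrow> (real \<Rightarrow> 'w \<Rightarrow> real) \<Rightarrow> bool" where
  "local_martingale P F Y \<longleftrightarrow> adapted F Y \<and> (AE \<omega> in P. cadlag (\<lambda>t. Y t \<omega>)) \<and>
     (\<exists>\<tau> :: nat \<Rightarrow> 'w \<Rightarrow> ennreal.
        (\<forall>n. stopping_time (closed_filtration P F) (\<tau> n)) \<and>
        (\<forall>\<omega>\<in>space P. incseq (\<lambda>n. \<tau> n \<omega>)) \<and>
        (AE \<omega> in P. (SUP n. \<tau> n \<omega>) = \<top>) \<and>
        (\<forall>n. martingale P F (stopped (\<tau> n) Y)))"

definition continuous_local_martingale ::
    "'w measure \<Rightarrow> (real \<Rightarrow> 'w measure) \<Rightarrow> (real \<Rightarrow> 'w \<Rightarrow> real) \<Rightarrow> bool" where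
  "continuous_local_martingale P F Y \<longleftrightarrow>
     local_martingale P F Y \<and> (AE \<omega> in P. continuous_on {0..} (\<lambda>t. Y t \<omega>))"

definition purely_discontinuous ::
    "'w measure \<Rightarrow> (real \<Rightarrow> 'w measure) \<Rightarrow> (real \<Rightarrow> 'w \<Rightarrow> real) \<Rightarrow> bool" where
  "purely_discontinuous P F Y \<longleftrightarrow> local_martingale P F Y \<and> (AE \<omega> in P. Y 0 \<omega> = 0) \<and>
     (\<forall>Z. continuous_local_martingale P F Z \<longrightarrow> local_martingale P F (\<lambda>t \<omega>. Y t \<omega> * Z t \<omega>))"

definition finite_variation_process ::
    "'w measure \<Rightarrow> (real \<Rightarrow> 'w measure) \<Rightarrow> (real \<Rightarrow> 'w \<Rightarrow> real) \<Rightarrow> bool" where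
  "finite_variation_process P F A \<longleftrightarrow> adapted F A \<and>
     (AE \<omega> in P. A 0 \<omega> = 0 \<and> cadlag (\<lambda>t. A t \<omega>) \<and> (\<forall>t\<ge>0. p_variation 1 (\<lambda>s. A s \<omega>) 0 t < \<top>))"

definition semimartingale :: "'w measure \<Rightarrow> (real \<Rightarrow> 'w measure) \<Rightarrow> (real \<Rightarrow> 'w \<Rightarrow> real) \<Rightarrow> bool" where
  "semimartingale P F Y \<longleftrightarrow> adapted F Y \<and>
     (\<exists>L A. local_martingale P F L \<and> (AE \<omega> in P. L 0 \<omega> = 0) \<and> finite_variation_process P F A \<and>
        (AE \<omega> in P. \<forall>t\<ge>0. Y t \<omega> = Y 0 \<omega> + L t \<omega> + A t \<omega>))"

definition continuous_martingale_part ::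
    "'w measure \<Rightarrow> (real \<Rightarrow> 'w measure) \<Rightarrow> (real \<Rightarrow> 'w \<Rightarrow> real) \<Rightarrow> (real \<Rightarrow> 'w \<Rightarrow> real) \<Rightarrow> bool" where
  "continuous_martingale_part P F Y Yc \<longleftrightarrow>
     continuous_local_martingale P F Yc \<and> (AE \<omega> in P. Yc 0 \<omega> = 0) \<and>
     (\<exists>Yd A. purely_discontinuous P F Yd \<and> finite_variation_process P F A \<and>
        (AE \<omega> in P. \<forall>t\<ge>0. Y t \<omega> = Y 0 \<omega> + Yc t \<omega> + Yd t \<omega> + A t \<omega>))"

text \<open>\<open>A\<close> is a version of the predictable covariation \<open>\<langle>Y, Z\<rangle>\<close>.\<close>

definition predictable_covariation ::
    "'w measure \<Rightarrow> (real \<Rightarrow> 'w measure) \<Rightarrow> (real \<Rightarrow> 'w \<Rightarrow> real) \<Rightarrow> (real \<Rightarrow> 'w \<Rightarrow> real)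
      \<Rightarrow> (real \<Rightarrow> 'w \<Rightarrow> real) \<Rightarrow> bool" where
  "predictable_covariation P F Y Z A \<longleftrightarrow> predictable P F A \<and> finite_variation_process P F A \<and>
     local_martingale P F (\<lambda>t \<omega>. Y t \<omega> * Z t \<omega> - A t \<omega>)"

text \<open>
  \<open>\<nu>\<close> is a version of the compensator of the jump measure
  \<open>\<mu> = (\<Sum>s>0 with jump. \<delta>(s, jump))\<close> of \<open>X\<close>: it is a predictable random measure and integrates
  every nonnegative predictable function to the same expectation as \<open>\<mu>\<close>.
\<close>

definition jump_compensator ::
    "'w measure \<Rightarrow> (real \<Rightarrow> 'w measure) \<Rightarrow> (real \<Rightarrow> 'w \<Rightarrow> real ^ 'd)
      \<Rightarrow> ('w \<Rightarrow> (real \<times> (real ^ 'd)) measure) \<Rightarrow> bool" where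
  "jump_compensator P F X \<nu> \<longleftrightarrow>
     (\<forall>\<omega>\<in>space P. sets (\<nu> \<omega>) = sets borel) \<and>
     (\<forall>W :: ('w \<times> real) \<times> (real ^ 'd) \<Rightarrow> ennreal.
        W \<in> borel_measurable (predictable_sigma P F \<Otimes>\<^sub>M borel) \<longrightarrow>
          (\<lambda>(\<omega>, t). \<integral>\<^sup>+ p. W ((\<omega>, fst p), snd p) * indicator ({0..t} \<times> UNIV) p \<partial>\<nu> \<omega>)
             \<in> borel_measurable (predictable_sigma P F) \<and>
          (\<integral>\<^sup>+ \<omega>. (\<integral>\<^sup>+ p. W ((\<omega>, fst p), snd p) * indicator ({0..} \<times> UNIV) p \<partial>\<nu> \<omega>) \<partial>P) =
          (\<integral>\<^sup>+ \<omega>. (\<integral>\<^sup>+ s. W ((\<omega>, s), jump (\<lambda>t. X t \<omega>) s)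
             \<partial>count_space {s. 0 < s \<and> jump (\<lambda>t. X t \<omega>) s \<noteq> 0}) \<partial>P))"

definition cutoff :: "(real ^ 'd \<Rightarrow> real) \<Rightarrow> bool" where
  "cutoff \<kappa> \<longleftrightarrow> \<kappa> \<in> borel_measurable borel \<and>
     (\<exists>r>0. \<forall>y. indicator (cball 0 r) y \<le> \<kappa> y \<and> \<kappa> y \<le> indicator (cball 0 (2 * r)) y)"

text \<open>The process with its big jumps removed; for a cadlag path the sum is finite.\<close>

definition truncated :: "(real ^ 'd \<Rightarrow> real) \<Rightarrow> (real \<Rightarrow> 'w \<Rightarrow> real ^ 'd) \<Rightarrow> real \<Rightarrow> 'w \<Rightarrow> real ^ 'd" where
  "truncated \<kappa> X t \<omega> = X t \<omega> -
     (let J = (\<lambda>s. jump (\<lambda>t. X t \<omega>) s) in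
      \<Sum>s \<in> {s. 0 < s \<and> s \<le> t \<and> J s \<noteq> \<kappa> (J s) *\<^sub>R J s}. J s - \<kappa> (J s) *\<^sub>R J s)"

text \<open>
  \<open>X\<close> is a semimartingale and \<open>(B, C, \<nu>)\<close> is a version of its characteristics relative to the
  truncation function \<open>\<lambda>y. \<kappa> y *\<^sub>R y\<close>: \<open>B\<close> is the predictable finite variation part of the special
  semimartingale \<open>truncated \<kappa> X\<close>, \<open>C\<close> the predictable covariation of the continuous martingale
  part and \<open>\<nu>\<close> the compensator of the jump measure.
\<close>

definition semimartingale_characteristics ::
    "'w measure \<Rightarrow> (real \<Rightarrow> 'w measure) \<Rightarrow> (real ^ 'd \<Rightarrow> real) \<Rightarrow> (real \<Rightarrow> 'w \<Rightarrow> real ^ 'd)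
      \<Rightarrow> (real \<Rightarrow> 'w \<Rightarrow> real ^ 'd) \<Rightarrow> (real \<Rightarrow> 'w \<Rightarrow> real ^ 'd ^ 'd)
      \<Rightarrow> ('w \<Rightarrow> (real \<times> (real ^ 'd)) measure) \<Rightarrow> bool" where
  "semimartingale_characteristics P F \<kappa> X B C \<nu> \<longleftrightarrow>
     (\<forall>i. semimartingale P F (\<lambda>t \<omega>. X t \<omega> $ i)) \<and>
     (\<forall>i. predictable P F (\<lambda>t \<omega>. B t \<omega> $ i) \<and> finite_variation_process P F (\<lambda>t \<omega>. B t \<omega> $ i) \<and>
          local_martingale P F (\<lambda>t \<omega>. truncated \<kappa> X t \<omega> $ i - X 0 \<omega> $ i - B t \<omega> $ i)) \<and>
     (\<exists>Xc. (\<forall>i. continuous_martingale_part P F (\<lambda>t \<omega>. X t \<omega> $ i) (Xc i)) \<and>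
           (\<forall>i j. predictable_covariation P F (Xc i) (Xc j) (\<lambda>t \<omega>. C t \<omega> $ i $ j))) \<and>
     jump_compensator P F X \<nu>"


section \<open>Markov, Hunt and Levy-type processes\<close>

text \<open>
  \<open>M\<close> carries the measurable space on which all the measures \<open>P x\<close> live; its own measure is
  irrelevant. The random variables \<open>X t\<close> take values in \<open>real ^ 'd\<close> (there is no cemetery state),
  so the process is conservative by its type.
\<close>

locale markov_process =
  fixes M :: "'w measure" and F :: "real \<Rightarrow> 'w measure"
    and X :: "real \<Rightarrow> 'w \<Rightarrow> real ^ 'd" and P :: "real ^ 'd \<Rightarrow> 'w measure"
  assumes filtration: "filtration (space M) (closed_filtration M F)"
    and prob: "\<And>x. P x \<in> space (prob_algebra M)"
    and adapted: "\<And>t. 0 \<le> t \<Longrightarrow> X t \<in> F t \<rightarrow>\<^sub>M borel"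
    and kernel: "\<And>t A. 0 \<le> t \<Longrightarrow> A \<in> sets borel \<Longrightarrow>
      (\<lambda>x. measure (P x) {\<omega> \<in> space M. X t \<omega> \<in> A}) \<in> borel_measurable borel"
    and markov: "\<And>x s t A. 0 \<le> s \<Longrightarrow> 0 \<le> t \<Longrightarrow> A \<in> sets borel \<Longrightarrow>
      AE \<omega> in P x. real_cond_exp (P x) (F s) (indicator {\<omega> \<in> space M. X (s + t) \<omega> \<in> A}) \<omega> =
        measure (P (X s \<omega>)) {\<omega>' \<in> space M. X t \<omega>' \<in> A}"

locale hunt_process = markov_process +
  assumes cadlag_paths: "\<And>\<omega>. \<omega> \<in> space M \<Longrightarrow> cadlag (\<lambda>t. X t \<omega>)"
    and strong_markov: "\<And>x \<tau> t A. stopping_time (closed_filtration M F) \<tau> \<Longrightarrow> 0 \<le> t \<Longrightarrow> A \<in> sets borel \<Longrightarrow>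
      AE \<omega> in P x.
        real_cond_exp (P x) (filtration.pre_sigma (space M) (closed_filtration M F) \<tau>)
          (indicator {\<omega> \<in> space M. \<tau> \<omega> < \<top> \<and> X (enn2real (\<tau> \<omega>) + t) \<omega> \<in> A}) \<omega> =
        (if \<tau> \<omega> < \<top> then measure (P (X (enn2real (\<tau> \<omega>)) \<omega>)) {\<omega>' \<in> space M. X t \<omega>' \<in> A} else 0)"
    and quasi_left_continuous: "\<And>x \<tau>.
      (\<And>n::nat. stopping_time (closed_filtration M F) (\<tau> n)) \<Longrightarrow>
      (\<And>\<omega>. \<omega> \<in> space M \<Longrightarrow> incseq (\<lambda>n. \<tau> n \<omega>)) \<Longrightarrow>
      AE \<omega> in P x. (SUP n. \<tau> n \<omega>) < \<top> \<longrightarrow>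
        (\<lambda>n. X (enn2real (\<tau> n \<omega>)) \<omega>) \<longlonglongrightarrow> X (enn2real (SUP n. \<tau> n \<omega>)) \<omega>"

definition normal_process ::
    "'w measure \<Rightarrow> (real \<Rightarrow> 'w \<Rightarrow> real ^ 'd) \<Rightarrow> (real ^ 'd \<Rightarrow> 'w measure) \<Rightarrow> bool" where
  "normal_process M X P \<longleftrightarrow> (\<forall>x. measure (P x) {\<omega> \<in> space M. X 0 \<omega> = x} = 1)"

definition positive_semidefinite :: "real ^ 'd ^ 'd \<Rightarrow> bool" where
  "positive_semidefinite A \<longleftrightarrow> transpose A = A \<and> (\<forall>v. 0 \<le> v \<bullet> (A *v v))"

text \<open>
  The last assumption says that \<open>\<nu>(\<omega>; ds, dy) = N(X\<^sub>s(\<omega>), dy) ds\<close> on \<open>[0, \<infinity>) \<times> \<real>\<^sup>d\<close>.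
  Integrability of \<open>1 \<and> \<parallel>y\<parallel>\<^sup>2\<close> makes the differential characteristic \<open>jump_intensity N\<close> below
  a real-valued function.
\<close>

locale levy_type_process = hunt_process M F X P
  for M :: "'w measure" and F :: "real \<Rightarrow> 'w measure"
    and X :: "real \<Rightarrow> 'w \<Rightarrow> real ^ 'd" and P :: "real ^ 'd \<Rightarrow> 'w measure" +
  fixes \<kappa> :: "real ^ 'd \<Rightarrow> real"
    and \<l> :: "real ^ 'd \<Rightarrow> real ^ 'd" and Q :: "real ^ 'd \<Rightarrow> real ^ 'd ^ 'd"
    and N :: "real ^ 'd \<Rightarrow> (real ^ 'd) measure"
  assumes cutoff: "cutoff \<kappa>"
    and drift_measurable: "\<l> \<in> borel_measurable borel"
    and diffusion_measurable: "Q \<in> borel_measurable borel"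
    and diffusion_psd: "\<And>x. positive_semidefinite (Q x)"
    and kernel_sets: "\<And>x. sets (N x) = sets borel"
    and kernel_measurable: "\<And>A. A \<in> sets borel \<Longrightarrow> (\<lambda>x. emeasure (N x) A) \<in> borel_measurable borel"
    and kernel_zero: "\<And>x. emeasure (N x) {0} = 0"
    and kernel_integrable: "\<And>x. set_integrable (N x) (- {0}) (\<lambda>y. min 1 ((norm y)\<^sup>2))"
    and drift_integrable: "\<And>x. AE \<omega> in P x. \<forall>t\<ge>0. set_integrable lborel {0..t} (\<lambda>s. \<l> (X s \<omega>))"
    and diffusion_integrable: "\<And>x. AE \<omega> in P x. \<forall>t\<ge>0. set_integrable lborel {0..t} (\<lambda>s. Q (X s \<omega>))"
    and characteristics: "\<exists>\<nu>. 
      (\<forall>\<omega>\<in>space M. \<forall>A\<in>sets borel.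
         emeasure (\<nu> \<omega>) A = (\<integral>\<^sup>+ s\<in>{0..}. emeasure (N (X s \<omega>)) {y. (s, y) \<in> A} \<partial>lborel)) \<and>
      (\<forall>x. semimartingale_characteristics (P x) F \<kappa> X
         (\<lambda>t \<omega>. LINT s:{0..t}|lborel. \<l> (X s \<omega>))
         (\<lambda>t \<omega>. LINT s:{0..t}|lborel. Q (X s \<omega>)) \<nu>)"

definition jump_intensity :: "(real ^ 'd \<Rightarrow> (real ^ 'd) measure) \<Rightarrow> real ^ 'd \<Rightarrow> real" where
  "jump_intensity N x = (LINT y:- {0}|N x. min 1 ((norm y)\<^sup>2))"

definition locally_bounded :: "(real ^ 'd \<Rightarrow> 'b::real_normed_vector) \<Rightarrow> bool" where
  "locally_bounded f \<longleftrightarrow> (\<forall>K. compact K \<longrightarrow> bounded (f ` K))"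

definition finely_continuous ::
    "(real \<Rightarrow> 'w \<Rightarrow> real ^ 'd) \<Rightarrow> (real ^ 'd \<Rightarrow> 'w measure) \<Rightarrow> (real ^ 'd \<Rightarrow> 'b::topological_space) \<Rightarrow> bool" where
  "finely_continuous X P f \<longleftrightarrow>
     (\<forall>x. AE \<omega> in P x. \<forall>t\<ge>0. ((\<lambda>s. f (X s \<omega>)) \<longlongrightarrow> f (X t \<omega>)) (at_right t))"


section \<open>Symbol and indices\<close>

text \<open>\<open>\<E>\<^sup>x exp (\<i> (X\<^sup>\<sigma>\<^sub>t - x)'\<xi>)\<close> for the first exit time \<open>\<sigma>\<close> from \<open>K\<close>.\<close>

definition stopped_char ::
    "(real \<Rightarrow> 'w \<Rightarrow> real ^ 'd) \<Rightarrow> (real ^ 'd \<Rightarrow> 'w measure) \<Rightarrow> (real ^ 'd) set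
      \<Rightarrow> real ^ 'd \<Rightarrow> real \<Rightarrow> real ^ 'd \<Rightarrow> complex" where
  "stopped_char X P K x t \<xi> =
     (\<integral>\<omega>. cis ((stopped (\<lambda>\<omega>. exit_time K (\<lambda>s. X s \<omega>)) X t \<omega> - x) \<bullet> \<xi>) \<partial>P x)"

definition has_symbol ::
    "(real \<Rightarrow> 'w \<Rightarrow> real ^ 'd) \<Rightarrow> (real ^ 'd \<Rightarrow> 'w measure)
      \<Rightarrow> (real ^ 'd \<Rightarrow> real ^ 'd \<Rightarrow> complex) \<Rightarrow> bool" where
  "has_symbol X P q \<longleftrightarrow>
     (\<forall>x \<xi> K. compact K \<longrightarrow> x \<in> interior K \<longrightarrow>
        ((\<lambda>t. - ((stopped_char X P K x t \<xi> - 1) / of_real t)) \<longlongrightarrow> q x \<xi>) (at_right 0))"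

definition spot_index :: "(real ^ 'd \<Rightarrow> real ^ 'd \<Rightarrow> complex) \<Rightarrow> real ^ 'd \<Rightarrow> ereal" where
  "spot_index q y =
     (INF \<delta> \<in> {\<delta>. 0 < \<delta> \<and> ((\<lambda>\<xi>. norm \<xi> powr (- \<delta>) * Re (q y \<xi>)) \<longlongrightarrow> 0) at_infinity}. ereal \<delta>)"

definition local_index :: "(real ^ 'd \<Rightarrow> real ^ 'd \<Rightarrow> complex) \<Rightarrow> real ^ 'd \<Rightarrow> ereal" where
  "local_index q x = (SUP R \<in> {0<..}. INF y \<in> cball x R. spot_index q y)"

definition condition_A ::
    "(real \<Rightarrow> 'w \<Rightarrow> real ^ 'd) \<Rightarrow> (real ^ 'd \<Rightarrow> 'w measure)
      \<Rightarrow> (real ^ 'd \<Rightarrow> real ^ 'd \<Rightarrow> complex) \<Rightarrow> real ^ 'd \<Rightarrow> real \<Rightarrow> real \<Rightarrow> bool" where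
  "condition_A X P q x \<delta>' R' \<longleftrightarrow>
     (\<forall>\<Delta>>0. continuous_on (cball x \<delta>' \<times> cball 0 \<Delta>) (\<lambda>(y, \<xi>). Re (q y \<xi>)) \<and>
       (\<forall>R. 0 < R \<longrightarrow> R < R' \<longrightarrow>
         ((\<lambda>t. SUP (y, \<xi>) \<in> cball x \<delta>' \<times> cball 0 \<Delta>.
             ennreal \<bar>(1 - Re (stopped_char X P (cball y R) y t \<xi>)) / t - Re (q y \<xi>)\<bar>) \<longlongrightarrow> 0)
           (at_right 0)))"

end

theory Submission
  imports Defs
begin

text \<open>
  For small \<open>h\<close>, Condition (A) bounds the expectation of \<open>1 - cos ((X\<^sub>h - y)'\<xi>)\<close> under \<open>P y\<close> below by
  \<open>h (Re q(y, \<xi>) - C)\<close>, uniformly for \<open>y\<close> near \<open>x\<close>, where \<open>C\<close> absorbs the stopping. Since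
  \<open>1 - cos u \<le> 2 (1 \<and> |u|) powr lam\<close> (the local index is at most \<open>2\<close>) and
  \<open>Re q(y, \<xi>) / |\<xi>| powr lam\<close> is unbounded in \<open>\<xi>\<close>, the expectation of
  \<open>(1 \<and> |X\<^sub>h - y|) powr lam\<close> eventually exceeds \<open>a h\<close> for every constant \<open>a\<close>. By the Markov property
  the sum of these truncated increments along a uniform partition then tends to infinity.
\<close>

text \<open>All control is local and carries no rate: the lower bound on increments holds only for
  starting points in a small ball about \<open>x\<close>, and the time scale below which it holds
  shrinks with \<open>a\<close> in an uncontrolled way. Hence each increment enters through
  \<open>exp (- Y)\<close>, killed when its left endpoint lies outside the ball; this makes the
  one-step estimate valid from every state. Expectations tending to \<open>0\<close> yield, by
  Fatou, only a vanishing lower limit, which is enough because the variation is a supremum over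
  partitions. Right continuity at time \<open>0\<close> provides a random initial interval inside
  the ball, and countably many deterministic intervals exhaust its possible lengths. Truncation at
  \<open>1\<close> keeps the increments integrable and in the range where \<open>exp (- t)\<close>
  lies below \<open>1 - t / 2\<close>.\<close>

section \<open>Trigonometric inequalities\<close>

lemma one_minus_cos_eq: "1 - cos u = 2 * (sin (u / 2))\<^sup>2" for u :: real
  using cos_double_sin[of "u / 2"] by simp

lemma abs_sin_nat_mult_le: "\<bar>sin (real k * v)\<bar> \<le> real k * \<bar>sin v\<bar>"
proof (induction k)
  case (Suc k)
  have "\<bar>sin (real (Suc k) * v)\<bar> = \<bar>sin (real k * v) * cos v + cos (real k * v) * sin v\<bar>"
    by (simp add: distrib_right sin_add algebra_simps)
  also have "\<dots> \<le> \<bar>sin (real k * v)\<bar> * \<bar>cos v\<bar> + \<bar>cos (real k * v)\<bar> * \<bar>sin v\<bar>"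
    by (metis abs_mult abs_triangle_ineq)
  also have "\<dots> \<le> \<bar>sin (real k * v)\<bar> * 1 + 1 * \<bar>sin v\<bar>"
    by (intro add_mono mult_mono) auto
  also have "\<dots> \<le> real (Suc k) * \<bar>sin v\<bar>"
    using Suc by (simp add: distrib_right)
  finally show ?case .
qed simp

lemma one_minus_cos_nat_mult_le: "1 - cos (real k * u) \<le> (real k)\<^sup>2 * (1 - cos u)"
proof -
  have "\<bar>sin (real k * (u / 2))\<bar>\<^sup>2 \<le> (real k * \<bar>sin (u / 2)\<bar>)\<^sup>2"
    by (intro power_mono abs_sin_nat_mult_le) auto
  then show ?thesis
    by (simp add: one_minus_cos_eq power_mult_distrib)
qed

text \<open>Near \<open>0\<close> the left side is of order \<open>u\<^sup>2\<close>, which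
  \<open>lam \<le> 2\<close> puts below \<open>\<bar>u\<bar> powr lam\<close>; beyond
  \<open>1\<close> the right side equals \<open>2\<close>, the maximum of the left.\<close>

lemma one_minus_cos_le_powr:
  fixes u lam :: real
  assumes "0 < lam" "lam \<le> 2"
  shows "1 - cos u \<le> 2 * min 1 \<bar>u\<bar> powr lam"
proof (cases "\<bar>u\<bar> \<le> 1")
  case True
  have "\<bar>sin (u / 2)\<bar>\<^sup>2 \<le> \<bar>u / 2\<bar>\<^sup>2"
    by (intro power_mono abs_sin_x_le_abs_x) auto
  then have "1 - cos u \<le> 2 * (\<bar>u\<bar>\<^sup>2 / 4)"
    by (simp add: one_minus_cos_eq power_divide)
  also have "\<dots> \<le> 2 * \<bar>u\<bar>\<^sup>2"
    by simp
  also have "\<bar>u\<bar>\<^sup>2 \<le> \<bar>u\<bar> powr lam"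
  proof (cases "u = 0")
    case False
    then have "\<bar>u\<bar>\<^sup>2 = \<bar>u\<bar> powr 2"
      by simp
    also have "\<dots> \<le> \<bar>u\<bar> powr lam"
      using True assms by (intro powr_mono') auto
    finally show ?thesis .
  qed auto
  finally show ?thesis
    using True by simp
next
  case False
  then show ?thesis
    using cos_ge_minus_one[of u] by simp
qed

section \<open>Tail bounds and measurability from characteristic functions\<close>

text \<open>Averaging \<open>1 - cos (u * U)\<close> over the frequencies \<open>0 \<le> u \<le> a\<close> gives \<open>1 - sin (a * U) / (a * U)\<close>.\<close>

lemma (in prob_space) prob_abs_ge_le_of_char:
  fixes U :: "'a \<Rightarrow> real"
  assumes U [measurable]: "random_variable borel U" and a: "0 < a"
    and C: "\<And>u. 0 \<le> u \<Longrightarrow> u \<le> a \<Longrightarrow> expectation (\<lambda>\<omega>. 1 - cos (u * U \<omega>)) \<le> C"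
  shows "prob {\<omega> \<in> space M. 2 / a \<le> \<bar>U \<omega>\<bar>} \<le> 2 * C"
proof -
  interpret pair_sigma_finite M lborel
    by unfold_locales
  have C0: "0 \<le> C"
    using C[of 0] a by simp
  have int: "integrable M (\<lambda>\<omega>. 1 - cos (u * U \<omega>))" for u
  proof (rule integrable_const_bound[where B = 2])
    show "AE \<omega> in M. norm (1 - cos (u * U \<omega>)) \<le> 2"
      using cos_ge_minus_one cos_le_one by (intro AE_I2) (smt (verit) real_norm_def)
  qed measurable
  let ?E = "{\<omega> \<in> space M. 2 / a \<le> \<bar>U \<omega>\<bar>}"
  \<comment> \<open>On \<open>?E\<close> the subtracted term
    \<open>sin (a * U \<omega>) / U \<omega>\<close> is at most
    \<open>1 / \<bar>U \<omega>\<bar> \<le> a / 2\<close>, so at least half of the interval length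
    survives. This is the origin of the threshold \<open>2 / a\<close>.\<close>
  have lower: "ennreal (a / 2) * indicator ?E \<omega> \<le>
      (\<integral>\<^sup>+ u. ennreal (1 - cos (u * U \<omega>)) * indicator {0..a} u \<partial>lborel)" if "\<omega> \<in> space M" for \<omega>
  proof (cases "\<omega> \<in> ?E")
    case True
    then have U2: "2 \<le> a * \<bar>U \<omega>\<bar>" and U0: "U \<omega> \<noteq> 0"
      using a by (auto simp: field_simps)
    have "(\<integral>\<^sup>+ u. ennreal (1 - cos (u * U \<omega>)) * indicator {0..a} u \<partial>lborel) =
        ennreal ((a - sin (a * U \<omega>) / U \<omega>) - (0 - sin (0 * U \<omega>) / U \<omega>))"
    proof (rule nn_integral_FTC_Icc[where F = "\<lambda>u. u - sin (u * U \<omega>) / U \<omega>"])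
      show "((\<lambda>u. u - sin (u * U \<omega>) / U \<omega>) has_real_derivative 1 - cos (u * U \<omega>)) (at u)"
        if "u \<in> {0..a}" for u
        using U0 by (auto intro!: derivative_eq_intros)
    qed (use a in auto)
    moreover have "sin (a * U \<omega>) / U \<omega> \<le> a / 2"
    proof -
      have "sin (a * U \<omega>) / U \<omega> \<le> \<bar>sin (a * U \<omega>)\<bar> / \<bar>U \<omega>\<bar>"
        by (metis abs_divide abs_ge_self)
      also have "\<dots> \<le> 1 / \<bar>U \<omega>\<bar>"
        by (intro divide_right_mono) auto
      also have "\<dots> \<le> a / 2"
        using U2 U0 by (simp add: field_simps)
      finally show ?thesis .
    qed
    ultimately show ?thesis
      using True by (simp add: ennreal_leI)
  qed auto
  have "ennreal (a / 2) * emeasure M ?E = (\<integral>\<^sup>+ \<omega>. ennreal (a / 2) * indicator ?E \<omega> \<partial>M)"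
    by (subst nn_integral_cmult_indicator) auto
  also have "\<dots> \<le> (\<integral>\<^sup>+ \<omega>. (\<integral>\<^sup>+ u. ennreal (1 - cos (u * U \<omega>)) * indicator {0..a} u \<partial>lborel) \<partial>M)"
    by (intro nn_integral_mono lower)
  also have "\<dots> = (\<integral>\<^sup>+ u. (\<integral>\<^sup>+ \<omega>. ennreal (1 - cos (u * U \<omega>)) * indicator {0..a} u \<partial>M) \<partial>lborel)"
    by (rule Fubini'[symmetric]) measurable
  also have "\<dots> \<le> (\<integral>\<^sup>+ u. ennreal C * indicator {0..a} u \<partial>lborel)"
  proof (rule nn_integral_mono)
    fix u
    have "(\<integral>\<^sup>+ \<omega>. ennreal (1 - cos (u * U \<omega>)) \<partial>M) = ennreal (expectation (\<lambda>\<omega>. 1 - cos (u * U \<omega>)))"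
      by (intro nn_integral_eq_integral int) auto
    then show "(\<integral>\<^sup>+ \<omega>. ennreal (1 - cos (u * U \<omega>)) * indicator {0..a} u \<partial>M) \<le> ennreal C * indicator {0..a} u"
      using C[of u] by (auto split: split_indicator intro: ennreal_leI)
  qed
  also have "\<dots> = ennreal (C * a)"
    using a C0 by (simp add: nn_integral_cmult_indicator ennreal_mult)
  finally have "ennreal (a / 2 * prob ?E) \<le> ennreal (C * a)"
    using a by (simp add: emeasure_eq_measure ennreal_mult'[symmetric])
  then have "a / 2 * prob ?E \<le> C * a"
    using C0 a by (subst (asm) ennreal_le_iff) auto
  then show ?thesis
    using a by (simp add: field_simps)
qed

text \<open>The norm is at most the sum of the absolute coordinates, so a vector of norm at least
  \<open>R\<close> has a coordinate of size at least \<open>R / DIM('b)\<close>. The frequency range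
  is what the one-dimensional bound needs for that threshold, and the union bound costs the factor
  \<open>DIM('b)\<close>.\<close>

lemma (in prob_space) prob_norm_ge_le_of_char:
  fixes Z :: "'a \<Rightarrow> 'b::euclidean_space" and C :: real
  assumes Z [measurable]: "random_variable borel Z" and R: "0 < R"
    and C: "\<And>\<xi>. norm \<xi> \<le> 2 * DIM('b) / R \<Longrightarrow> expectation (\<lambda>\<omega>. 1 - cos (Z \<omega> \<bullet> \<xi>)) \<le> C"
  shows "prob {\<omega> \<in> space M. R \<le> norm (Z \<omega>)} \<le> 2 * DIM('b) * C"
proof -
  let ?a = "2 * DIM('b) / R"
  have a: "0 < ?a"
    using R by simp
  have "{\<omega> \<in> space M. R \<le> norm (Z \<omega>)} \<subseteq> (\<Union>b\<in>Basis. {\<omega> \<in> space M. 2 / ?a \<le> \<bar>Z \<omega> \<bullet> b\<bar>})"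
  proof safe
    fix \<omega> assume "\<omega> \<in> space M" "R \<le> norm (Z \<omega>)"
    have "\<exists>b\<in>Basis. R / DIM('b) \<le> \<bar>Z \<omega> \<bullet> b\<bar>"
    proof (rule ccontr)
      assume "\<not> ?thesis"
      then have "(\<Sum>b\<in>Basis. \<bar>Z \<omega> \<bullet> b\<bar>) < (\<Sum>b\<in>(Basis::'b set). R / DIM('b))"
        by (intro sum_strict_mono) auto
      then show False
        using norm_le_l1[of "Z \<omega>"] \<open>R \<le> norm (Z \<omega>)\<close> by simp
    qed
    then show "\<omega> \<in> (\<Union>b\<in>Basis. {\<omega> \<in> space M. 2 / ?a \<le> \<bar>Z \<omega> \<bullet> b\<bar>})"
      using \<open>\<omega> \<in> space M\<close> by simp
  qed
  then have "prob {\<omega> \<in> space M. R \<le> norm (Z \<omega>)} \<le> prob (\<Union>b\<in>Basis. {\<omega> \<in> space M. 2 / ?a \<le> \<bar>Z \<omega> \<bullet> b\<bar>})"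
    by (intro finite_measure_mono) auto
  also have "\<dots> \<le> (\<Sum>b\<in>Basis. prob {\<omega> \<in> space M. 2 / ?a \<le> \<bar>Z \<omega> \<bullet> b\<bar>})"
    by (intro finite_measure_subadditive_finite) auto
  also have "\<dots> \<le> (\<Sum>b\<in>(Basis::'b set). 2 * C)"
  proof (intro sum_mono prob_abs_ge_le_of_char a)
    fix b :: 'b and u :: real
    assume "b \<in> Basis" "0 \<le> u" "u \<le> ?a"
    then show "expectation (\<lambda>\<omega>. 1 - cos (u * (Z \<omega> \<bullet> b))) \<le> C"
      using C[of "u *\<^sub>R b"] by simp
  qed simp
  finally show ?thesis
    by simp
qed

text \<open>Each coordinate is a derivative at frequency \<open>0\<close>: the limit of
  \<open>sin (u * (Z \<omega> \<bullet> b)) / u\<close> as \<open>u\<close> tends to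
  \<open>0\<close>. Arbitrarily small frequencies suffice, so any positive \<open>\<Delta>\<close>
  will do.\<close>

lemma borel_measurable_of_integrable_cis:
  fixes Z :: "'a \<Rightarrow> 'b::euclidean_space"
  assumes "0 < \<Delta>" and int: "\<And>\<xi>. norm \<xi> \<le> \<Delta> \<Longrightarrow> integrable M (\<lambda>\<omega>. cis (Z \<omega> \<bullet> \<xi>))"
  shows "Z \<in> borel_measurable M"
proof (rule borel_measurable_euclidean_space[THEN iffD2], rule ballI)
  fix b :: 'b assume b: "b \<in> Basis"
  define u where "u n = \<Delta> / real (Suc n)" for n
  have u: "0 < u n" "u n \<le> \<Delta>" for n
    using \<open>0 < \<Delta>\<close> by (auto simp: u_def field_simps)
  have u_lim: "u \<longlonglongrightarrow> 0"
    unfolding u_def by (rule LIMSEQ_Suc[OF lim_const_over_n])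
  show "(\<lambda>\<omega>. Z \<omega> \<bullet> b) \<in> borel_measurable M"
  proof (rule borel_measurable_LIMSEQ_real)
    fix n
    have "(\<lambda>\<omega>. Im (cis (Z \<omega> \<bullet> (u n *\<^sub>R b)))) \<in> borel_measurable M"
      using u[of n] b
      by (intro measurable_compose[OF _ borel_measurable_Im] borel_measurable_integrable[OF int]) auto
    then show "(\<lambda>\<omega>. sin (u n * (Z \<omega> \<bullet> b)) / u n) \<in> borel_measurable M"
      by simp
  next
    fix \<omega>
    have "((\<lambda>v. sin (v * (Z \<omega> \<bullet> b))) has_real_derivative cos (0 * (Z \<omega> \<bullet> b)) * (Z \<omega> \<bullet> b)) (at 0)"
      by (auto intro!: derivative_eq_intros)
    then have "((\<lambda>v. sin (v * (Z \<omega> \<bullet> b)) / v) \<longlongrightarrow> Z \<omega> \<bullet> b) (at 0)"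
      by (simp add: has_field_derivative_iff)
    then show "(\<lambda>n. sin (u n * (Z \<omega> \<bullet> b)) / u n) \<longlonglongrightarrow> Z \<omega> \<bullet> b"
      by (rule filterlim_compose) (use u u_lim in \<open>auto simp: filterlim_at less_imp_neq[symmetric]\<close>)
  qed
qed

section \<open>The stopped process and small-time estimates from Condition (A)\<close>

text \<open>If the path at its exit time were in the open ball, right continuity would keep it there
  a little longer and the infimum would be larger. The infimum need not be attained, so the path may
  sit on the sphere at that time; hence \<open>R \<le>\<close> and not a strict inequality.\<close>

lemma stopped_exit_cball_neq:
  fixes X :: "real \<Rightarrow> 'w \<Rightarrow> 'b::real_normed_vector"
  assumes path: "cadlag (\<lambda>t. X t \<omega>)" and h: "0 \<le> h"
    and neq: "stopped (\<lambda>\<omega>. exit_time (cball y R) (\<lambda>s. X s \<omega>)) X h \<omega> \<noteq> X h \<omega>"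
  shows "R \<le> norm (stopped (\<lambda>\<omega>. exit_time (cball y R) (\<lambda>s. X s \<omega>)) X h \<omega> - y)"
proof -
  let ?A = "{t. 0 \<le> t \<and> X t \<omega> \<notin> cball y R}"
  define \<sigma> where "\<sigma> = exit_time (cball y R) (\<lambda>s. X s \<omega>)"
  have \<sigma>h: "\<sigma> < ennreal h"
  proof (rule ccontr)
    assume "\<not> \<sigma> < ennreal h"
    then show False
      using neq h by (simp add: stopped_def \<sigma>_def[symmetric] min_absorb1 not_less)
  qed
  define s where "s = enn2real \<sigma>"
  have s: "0 \<le> s" "\<sigma> = ennreal s"
    using \<sigma>h by (auto simp: s_def ennreal_enn2real_if)
  have Zs: "stopped (\<lambda>\<omega>. exit_time (cball y R) (\<lambda>s. X s \<omega>)) X h \<omega> = X s \<omega>"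
    using \<sigma>h by (simp add: stopped_def \<sigma>_def[symmetric] s_def min_absorb2 less_imp_le)
  have "R \<le> norm (X s \<omega> - y)"
  proof (rule ccontr)
    assume "\<not> ?thesis"
    then have ball: "X s \<omega> \<in> ball y R"
      by (simp add: dist_norm norm_minus_commute)
    have "((\<lambda>t. X t \<omega>) \<longlongrightarrow> X s \<omega>) (at_right s)"
      using path s(1) by (simp add: cadlag_def)
    then have "\<forall>\<^sub>F t in at_right s. X t \<omega> \<in> ball y R"
      using ball by (rule topological_tendstoD[OF _ open_ball])
    then obtain b where b: "s < b" "\<And>t. s < t \<Longrightarrow> t < b \<Longrightarrow> X t \<omega> \<in> ball y R"
      by (auto simp: eventually_at_right_field)
    have "ennreal b \<le> \<sigma>"
      unfolding \<sigma>_def exit_time_def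
    proof (rule INF_greatest)
      fix t assume t: "t \<in> ?A"
      have "\<sigma> \<le> ennreal t"
        unfolding \<sigma>_def exit_time_def using t by (rule INF_lower)
      then have "s \<le> t"
        using s t by simp
      moreover have "t \<noteq> s"
        using t ball by (auto simp: less_imp_le)
      ultimately have "\<not> t < b"
        using b(2)[of t] t by (force simp: less_imp_le)
      then show "ennreal b \<le> ennreal t"
        by (simp add: ennreal_leI)
    qed
    then show False
      using b(1) s by simp
  qed
  then show ?thesis
    by (simp add: Zs)
qed

context hunt_process
begin

lemma prob_space_P: "prob_space (P y)"
  and sets_P [measurable_cong]: "sets (P y) = sets M"
  and space_P: "space (P y) = space M"
  using prob[of y] by (auto simp: space_prob_algebra dest: sets_eq_imp_space_eq)

lemma space_F: "0 \<le> t \<Longrightarrow> space (F t) = space M"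
  using filtration.space_F[OF filtration, of "ennreal t"] by (simp add: closed_filtration_def)

lemma sets_F_mono: "0 \<le> s \<Longrightarrow> s \<le> t \<Longrightarrow> sets (F s) \<subseteq> sets (F t)"
  using filtration.sets_F_mono[OF filtration, of "ennreal s" "ennreal t"]
  by (simp add: closed_filtration_def)

lemma sets_F_subset: "0 \<le> t \<Longrightarrow> sets (F t) \<subseteq> sets M"
  using filtration.sets_F_mono[OF filtration, of "ennreal t" \<top>] by (simp add: closed_filtration_def)

lemma subalgebra_F: "0 \<le> t \<Longrightarrow> subalgebra (P y) (F t)"
  by (simp add: subalgebra_def space_F space_P sets_F_subset sets_P)

lemma measurable_X: "0 \<le> t \<Longrightarrow> X t \<in> borel_measurable M"
  using adapted measurable_mono[OF order_refl refl sets_F_subset space_F] by blast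

abbreviation stopped_at_ball :: "real ^ 'b \<Rightarrow> real \<Rightarrow> real \<Rightarrow> 'a \<Rightarrow> real ^ 'b" where
  "stopped_at_ball y R \<equiv> stopped (\<lambda>\<omega>. exit_time (cball y R) (\<lambda>s. X s \<omega>)) X"

lemma stopped_char_eq:
  "stopped_char X P (cball y R) y t \<xi> = (\<integral>\<omega>. cis ((stopped_at_ball y R t \<omega> - y) \<bullet> \<xi>) \<partial>P y)"
  by (simp add: stopped_char_def)

lemma norm_stopped_char_le_1: "norm (stopped_char X P K y t \<xi>) \<le> 1"
proof -
  interpret P: prob_space "P y"
    by (rule prob_space_P)
  have "norm (stopped_char X P K y t \<xi>) \<le> (\<integral>\<omega>. 1 \<partial>P y)"
    unfolding stopped_char_def by (rule order_trans[OF integral_norm_bound]) simp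
  then show ?thesis
    by (simp add: P.prob_space)
qed

text \<open>
  Measurability of the stopped process comes for free: a non-integrable integrand would make the
  Bochner integral in the definition of the characteristic function vanish, and then the difference
  quotient in Condition (A) would blow up as \<open>1 / h\<close>.
\<close>

lemma condition_A_small_time:
  assumes A: "condition_A X P q x \<delta>' R'" and R: "0 < R" "R < R'" and \<Delta>: "0 < \<Delta>"
  obtains h0 where "0 < h0"
    and "\<And>h y. 0 < h \<Longrightarrow> h < h0 \<Longrightarrow> y \<in> cball x \<delta>' \<Longrightarrow> stopped_at_ball y R h \<in> borel_measurable (P y)"
    and "\<And>h y \<xi>. 0 < h \<Longrightarrow> h < h0 \<Longrightarrow> y \<in> cball x \<delta>' \<Longrightarrow> norm \<xi> \<le> \<Delta> \<Longrightarrow>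
      \<bar>(\<integral>\<omega>. 1 - cos ((stopped_at_ball y R h \<omega> - y) \<bullet> \<xi>) \<partial>P y) - h * Re (q y \<xi>)\<bar> \<le> h"
proof -
  let ?B = "cball x \<delta>' \<times> cball (0 :: real ^ 'b) \<Delta>"
  have cont: "continuous_on ?B (\<lambda>(y, \<xi>). Re (q y \<xi>))"
    and lim: "((\<lambda>t. SUP (y, \<xi>) \<in> ?B. ennreal \<bar>(1 - Re (stopped_char X P (cball y R) y t \<xi>)) / t - Re (q y \<xi>)\<bar>)
      \<longlongrightarrow> 0) (at_right 0)"
    using A R \<Delta> by (auto simp: condition_A_def)
  have "bounded ((\<lambda>(y, \<xi>). Re (q y \<xi>)) ` ?B)"
    by (intro compact_imp_bounded compact_continuous_image cont compact_Times compact_cball)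
  then obtain C where C: "\<And>y \<xi>. (y, \<xi>) \<in> ?B \<Longrightarrow> \<bar>Re (q y \<xi>)\<bar> \<le> C"
    by (force simp: bounded_iff)
  have "\<forall>\<^sub>F t in at_right 0. (SUP (y, \<xi>) \<in> ?B. ennreal \<bar>(1 - Re (stopped_char X P (cball y R) y t \<xi>)) / t - Re (q y \<xi>)\<bar>) < 1"
    using lim by (rule order_tendstoD) simp
  then obtain b where b: "0 < b" "\<And>t. 0 < t \<Longrightarrow> t < b \<Longrightarrow>
      (SUP (y, \<xi>) \<in> ?B. ennreal \<bar>(1 - Re (stopped_char X P (cball y R) y t \<xi>)) / t - Re (q y \<xi>)\<bar>) < 1"
    by (auto simp: eventually_at_right_field)
  have quot: "\<bar>(1 - Re (stopped_char X P (cball y R) y t \<xi>)) / t - Re (q y \<xi>)\<bar> < 1"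
    if "0 < t" "t < b" "(y, \<xi>) \<in> ?B" for t y and \<xi> :: "real ^ 'b"
  proof -
    have "ennreal \<bar>(1 - Re (stopped_char X P (cball y R) y t \<xi>)) / t - Re (q y \<xi>)\<bar> < 1"
      by (rule le_less_trans[OF _ b(2)[OF that(1,2)]]) (rule SUP_upper2[OF that(3)], simp)
    then show ?thesis
      by (simp add: ennreal_less_one_iff)
  qed
  \<comment> \<open>A vanishing characteristic function would give
    \<open>1 / h < \<bar>C\<bar> + 1\<close>; the second bound on \<open>h\<close> rules this
    out.\<close>
  define h0 where "h0 = min b (1 / (\<bar>C\<bar> + 1))"
  have h0: "0 < h0"
    using b by (simp add: h0_def)
  have int: "integrable (P y) (\<lambda>\<omega>. cis ((stopped_at_ball y R h \<omega> - y) \<bullet> \<xi>))"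
    if h: "0 < h" "h < h0" and y: "(y, \<xi>) \<in> ?B" for h y and \<xi> :: "real ^ 'b"
  proof (rule ccontr)
    assume "\<not> ?thesis"
    then have "stopped_char X P (cball y R) y h \<xi> = 0"
      by (simp add: stopped_char_eq not_integrable_integral_eq)
    then have "\<bar>1 / h - Re (q y \<xi>)\<bar> < 1"
      using quot[OF h(1) _ y] h by (simp add: h0_def)
    then have "1 / h < \<bar>C\<bar> + 1"
      using C[OF y] by linarith
    moreover have "\<bar>C\<bar> + 1 \<le> 1 / h"
      using h by (simp add: h0_def field_simps)
    ultimately show False
      by simp
  qed
  have meas: "stopped_at_ball y R h \<in> borel_measurable (P y)"
    if "0 < h" "h < h0" "y \<in> cball x \<delta>'" for h y
  proof -
    have "(\<lambda>\<omega>. stopped_at_ball y R h \<omega> - y) \<in> borel_measurable (P y)"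
      by (rule borel_measurable_of_integrable_cis[OF \<Delta>]) (use int that in auto)
    then have "(\<lambda>\<omega>. (stopped_at_ball y R h \<omega> - y) + y) \<in> borel_measurable (P y)"
      by measurable
    then show ?thesis
      by simp
  qed
  show thesis
  proof (rule that[OF h0 meas])
    fix h and y \<xi> :: "real ^ 'b"
    assume h: "0 < h" "h < h0" and y: "y \<in> cball x \<delta>'" and \<xi>: "norm \<xi> \<le> \<Delta>"
    interpret P: prob_space "P y"
      by (rule prob_space_P)
    have B: "(y, \<xi>) \<in> ?B"
      using y \<xi> by simp
    note int' = int[OF h B]
    have "(\<integral>\<omega>. 1 - cos ((stopped_at_ball y R h \<omega> - y) \<bullet> \<xi>) \<partial>P y) =
        1 - Re (stopped_char X P (cball y R) y h \<xi>)"
      using integrable_Re[OF int'] integral_Re[OF int', symmetric]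
      by (simp add: stopped_char_eq P.prob_space)
    then show "\<bar>(\<integral>\<omega>. 1 - cos ((stopped_at_ball y R h \<omega> - y) \<bullet> \<xi>) \<partial>P y) - h * Re (q y \<xi>)\<bar> \<le> h"
      using quot[OF h(1) _ B] h by (auto simp: h0_def abs_less_iff abs_le_iff field_simps)
  qed
qed

end

text \<open>Serves two ends: with \<open>p = 2\<close> it bounds the spot index at \<open>x\<close>,
  and by contraposition it turns missing decay at exponent \<open>c\<close> into frequencies where
  \<open>f\<close> exceeds a prescribed multiple of \<open>norm \<xi> powr p\<close>.\<close>

lemma tendsto_norm_powr_times_0:
  fixes f :: "'b::real_normed_vector \<Rightarrow> real"
  assumes "\<And>\<xi>. 0 \<le> f \<xi>" and le: "\<And>\<xi>. 1 \<le> norm \<xi> \<Longrightarrow> f \<xi> \<le> C * norm \<xi> powr p" and "p < c"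
  shows "((\<lambda>\<xi>. norm \<xi> powr (- c) * f \<xi>) \<longlongrightarrow> 0) at_infinity"
proof (rule tendsto_sandwich[OF _ _ tendsto_const])
  show "\<forall>\<^sub>F \<xi> in at_infinity. 0 \<le> norm \<xi> powr (- c) * f \<xi>"
    using assms(1) by simp
  have "norm \<xi> powr (- c) * f \<xi> \<le> C * norm \<xi> powr (p - c)" if "1 \<le> norm \<xi>" for \<xi>
  proof -
    have "norm \<xi> powr (- c) * f \<xi> \<le> norm \<xi> powr (- c) * (C * norm \<xi> powr p)"
      using le[OF that] by (intro mult_left_mono) auto
    also have "\<dots> = C * norm \<xi> powr (- c + p)"
      by (simp only: powr_add mult_ac)
    finally show ?thesis
      by simp
  qed
  then show "\<forall>\<^sub>F \<xi> in at_infinity. norm \<xi> powr (- c) * f \<xi> \<le> C * norm \<xi> powr (p - c)"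
    by (auto simp: eventually_at_infinity)
  have "((\<lambda>\<xi>::'b. C * norm \<xi> powr (p - c)) \<longlongrightarrow> C * 0) at_infinity"
    using \<open>p < c\<close> by (intro tendsto_mult_left tendsto_neg_powr filterlim_norm_at_top) auto
  then show "((\<lambda>\<xi>::'b. C * norm \<xi> powr (p - c)) \<longlongrightarrow> 0) at_infinity"
    by simp
qed

context hunt_process
begin

text \<open>The tail inequality asks only for frequencies up to a radius fixed by \<open>R\<close>.
  There \<open>Re q\<close> is bounded by compactness, so Condition (A) makes the expectation of
  \<open>1 - cos\<close> of order \<open>h\<close>, uniformly in \<open>y\<close>. The linear rate
  is what later lets stopping cost only an additive constant.\<close>

lemma condition_A_exit_prob:
  assumes A: "condition_A X P q x \<delta>' R'" and R: "0 < R" "R < R'"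
  obtains h0 C where "0 < h0"
    and "\<And>h y. 0 < h \<Longrightarrow> h < h0 \<Longrightarrow> y \<in> cball x \<delta>' \<Longrightarrow>
      measure (P y) {\<omega> \<in> space (P y). R \<le> norm (stopped_at_ball y R h \<omega> - y)} \<le> C * h"
proof -
  define \<Delta> where "\<Delta> = 2 * DIM(real ^ 'b) / R"
  have \<Delta>: "0 < \<Delta>"
    using R by (simp add: \<Delta>_def)
  let ?B = "cball x \<delta>' \<times> cball (0 :: real ^ 'b) \<Delta>"
  have "bounded ((\<lambda>(y, \<xi>). Re (q y \<xi>)) ` ?B)"
    using A \<Delta> unfolding condition_A_def
    by (intro compact_imp_bounded compact_continuous_image compact_Times compact_cball) auto
  then obtain C where C: "\<And>y \<xi>. (y, \<xi>) \<in> ?B \<Longrightarrow> \<bar>Re (q y \<xi>)\<bar> \<le> C"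
    by (force simp: bounded_iff)
  obtain h0 where h0: "0 < h0"
    and meas: "\<And>h y. 0 < h \<Longrightarrow> h < h0 \<Longrightarrow> y \<in> cball x \<delta>' \<Longrightarrow> stopped_at_ball y R h \<in> borel_measurable (P y)"
    and bound: "\<And>h y \<xi>. 0 < h \<Longrightarrow> h < h0 \<Longrightarrow> y \<in> cball x \<delta>' \<Longrightarrow> norm \<xi> \<le> \<Delta> \<Longrightarrow>
      \<bar>(\<integral>\<omega>. 1 - cos ((stopped_at_ball y R h \<omega> - y) \<bullet> \<xi>) \<partial>P y) - h * Re (q y \<xi>)\<bar> \<le> h"
    using condition_A_small_time[OF A R \<Delta>] by blast
  show thesis
  proof (rule that[OF h0])
    fix h y assume h: "0 < h" "h < h0" and y: "y \<in> cball x \<delta>'"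
    interpret P: prob_space "P y"
      by (rule prob_space_P)
    note [measurable] = meas[OF h y]
    have "P.prob {\<omega> \<in> space (P y). R \<le> norm (stopped_at_ball y R h \<omega> - y)} \<le> 2 * DIM(real ^ 'b) * (h * (C + 1))"
    proof (rule P.prob_norm_ge_le_of_char)
      fix \<xi> :: "real ^ 'b" assume \<xi>: "norm \<xi> \<le> 2 * DIM(real ^ 'b) / R"
      then have "(\<integral>\<omega>. 1 - cos ((stopped_at_ball y R h \<omega> - y) \<bullet> \<xi>) \<partial>P y) \<le> h * Re (q y \<xi>) + h"
        using bound[OF h y, of \<xi>] by (simp add: \<Delta>_def)
      also have "\<dots> \<le> h * C + h"
        using C[of y \<xi>] \<xi> y h by (intro add_mono mult_left_mono) (auto simp: \<Delta>_def)
      finally show "(\<integral>\<omega>. 1 - cos ((stopped_at_ball y R h \<omega> - y) \<bullet> \<xi>) \<partial>P y) \<le> h * (C + 1)"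
        by (simp add: distrib_left)
    qed (use R in auto)
    then show "P.prob {\<omega> \<in> space (P y). R \<le> norm (stopped_at_ball y R h \<omega> - y)} \<le> 2 * DIM(real ^ 'b) * (C + 1) * h"
      by (simp add: algebra_simps)
  qed
qed

text \<open>
  The stopped and the unstopped increment differ only if the former has norm at least \<open>R\<close>, so
  the stopping costs a constant \<open>C\<close> that does not depend on the frequency range \<open>\<Delta>\<close>.
\<close>

lemma condition_A_char_lower_bound:
  assumes A: "condition_A X P q x \<delta>' R'" and R': "0 < R'"
  obtains C where "\<And>\<Delta>. 0 < \<Delta> \<Longrightarrow> \<exists>h0>0. \<forall>h y \<xi>. 0 < h \<longrightarrow> h < h0 \<longrightarrow> y \<in> cball x \<delta>' \<longrightarrow> norm \<xi> \<le> \<Delta> \<longrightarrow>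
      h * (Re (q y \<xi>) - C) \<le> (\<integral>\<omega>. 1 - cos ((X h \<omega> - y) \<bullet> \<xi>) \<partial>P y)"
proof -
  define R where "R = R' / 2"
  have R: "0 < R" "R < R'"
    using R' by (auto simp: R_def)
  obtain h1 C where h1: "0 < h1" and exit:
    "\<And>h y. 0 < h \<Longrightarrow> h < h1 \<Longrightarrow> y \<in> cball x \<delta>' \<Longrightarrow>
      measure (P y) {\<omega> \<in> space (P y). R \<le> norm (stopped_at_ball y R h \<omega> - y)} \<le> C * h"
    using condition_A_exit_prob[OF A R] by blast
  \<comment> \<open>The \<open>1\<close> is the error left by Condition (A). The
    \<open>2 * C\<close> pays for the event where the stopped and unstopped values may differ: its
    probability is at most \<open>C * h\<close>, and the integrands there differ by at most
    \<open>2\<close>.\<close>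
  show thesis
  proof (rule that[of "1 + 2 * C"])
    fix \<Delta> :: real assume \<Delta>: "0 < \<Delta>"
    obtain h0 where h0: "0 < h0"
      and meas: "\<And>h y. 0 < h \<Longrightarrow> h < h0 \<Longrightarrow> y \<in> cball x \<delta>' \<Longrightarrow> stopped_at_ball y R h \<in> borel_measurable (P y)"
      and bound: "\<And>h y \<xi>. 0 < h \<Longrightarrow> h < h0 \<Longrightarrow> y \<in> cball x \<delta>' \<Longrightarrow> norm \<xi> \<le> \<Delta> \<Longrightarrow>
        \<bar>(\<integral>\<omega>. 1 - cos ((stopped_at_ball y R h \<omega> - y) \<bullet> \<xi>) \<partial>P y) - h * Re (q y \<xi>)\<bar> \<le> h"
      using condition_A_small_time[OF A R \<Delta>] by blast
    have "h * (Re (q y \<xi>) - (1 + 2 * C)) \<le> (\<integral>\<omega>. 1 - cos ((X h \<omega> - y) \<bullet> \<xi>) \<partial>P y)"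
      if h: "0 < h" "h < min h0 h1" and y: "y \<in> cball x \<delta>'" and \<xi>: "norm \<xi> \<le> \<Delta>" for h y \<xi>
    proof -
      interpret P: prob_space "P y"
        by (rule prob_space_P)
      let ?Z = "stopped_at_ball y R h"
      let ?E = "{\<omega> \<in> space (P y). R \<le> norm (?Z \<omega> - y)}"
      have hh: "h < h0" "h < h1"
        using h by auto
      note [measurable] = meas[OF h(1) hh(1) y]
      have [measurable]: "X h \<in> borel_measurable (P y)"
        using h measurable_X[of h] by simp
      have bnd: "norm (1 - cos u) \<le> 2" for u :: real
        using cos_ge_minus_one[of u] by simp
      have int: "integrable (P y) (\<lambda>\<omega>. 1 - cos ((?Z \<omega> - y) \<bullet> \<xi>))" "integrable (P y) (\<lambda>\<omega>. 1 - cos ((X h \<omega> - y) \<bullet> \<xi>))"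
        by (rule P.integrable_const_bound[where B = 2], intro AE_I2 bnd, measurable)+
      have intE: "integrable (P y) (\<lambda>\<omega>. indicator ?E \<omega> :: real)"
        by (rule P.integrable_const_bound[where B = 1]) auto
      have "(\<integral>\<omega>. 1 - cos ((?Z \<omega> - y) \<bullet> \<xi>) \<partial>P y) \<le> (\<integral>\<omega>. 1 - cos ((X h \<omega> - y) \<bullet> \<xi>) + 2 * indicator ?E \<omega> \<partial>P y)"
      proof (intro integral_mono int Bochner_Integration.integrable_add integrable_mult_right intE)
        fix \<omega> assume \<omega>: "\<omega> \<in> space (P y)"
        then have path: "cadlag (\<lambda>t. X t \<omega>)"
          by (intro cadlag_paths) (simp add: space_P)
        show "1 - cos ((?Z \<omega> - y) \<bullet> \<xi>) \<le> 1 - cos ((X h \<omega> - y) \<bullet> \<xi>) + 2 * indicator ?E \<omega>"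
        proof (cases "?Z \<omega> = X h \<omega>")
          case False
          then have "\<omega> \<in> ?E"
            using \<omega> stopped_exit_cball_neq[where X = X and \<omega> = \<omega>, OF path, of h y R] h(1) by simp
          then show ?thesis
            using cos_ge_minus_one[of "(?Z \<omega> - y) \<bullet> \<xi>"] cos_le_one[of "(X h \<omega> - y) \<bullet> \<xi>"]
            by (simp del: cos_le_one cos_ge_minus_one)
        qed (auto split: split_indicator)
      qed
      also have "\<dots> = (\<integral>\<omega>. 1 - cos ((X h \<omega> - y) \<bullet> \<xi>) \<partial>P y) + 2 * P.prob ?E"
        by (subst Bochner_Integration.integral_add[OF int(2)]) (use intE in auto)
      finally have "(\<integral>\<omega>. 1 - cos ((?Z \<omega> - y) \<bullet> \<xi>) \<partial>P y) \<le> (\<integral>\<omega>. 1 - cos ((X h \<omega> - y) \<bullet> \<xi>) \<partial>P y) + 2 * (C * h)"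
        using exit[OF h(1) hh(2) y] by linarith
      then show ?thesis
        using bound[OF h(1) hh(1) y \<xi>] by (simp add: algebra_simps abs_le_iff)
    qed
    then show "\<exists>h0>0. \<forall>h y \<xi>. 0 < h \<longrightarrow> h < h0 \<longrightarrow> y \<in> cball x \<delta>' \<longrightarrow> norm \<xi> \<le> \<Delta> \<longrightarrow>
      h * (Re (q y \<xi>) - (1 + 2 * C)) \<le> (\<integral>\<omega>. 1 - cos ((X h \<omega> - y) \<bullet> \<xi>) \<partial>P y)"
      using h0 h1 by (intro exI[of _ "min h0 h1"]) auto
  qed
qed

section \<open>Growth of the symbol and the upper bound for the local index\<close>

lemma has_symbol_Re:
  assumes "has_symbol X P q" "0 < R"
  shows "((\<lambda>t. (1 - Re (stopped_char X P (cball y R) y t \<xi>)) / t) \<longlongrightarrow> Re (q y \<xi>)) (at_right 0)"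
proof -
  have "((\<lambda>t. - ((stopped_char X P (cball y R) y t \<xi> - 1) / of_real t)) \<longlongrightarrow> q y \<xi>) (at_right 0)"
    using assms by (auto simp: has_symbol_def)
  from tendsto_Re[OF this] show ?thesis
    by (simp add: diff_divide_distrib)
qed

lemma has_symbol_Re_nonneg:
  assumes "has_symbol X P q"
  shows "0 \<le> Re (q y \<xi>)"
proof (rule tendsto_lowerbound[OF has_symbol_Re[OF assms zero_less_one]])
  show "\<forall>\<^sub>F t in at_right 0. 0 \<le> (1 - Re (stopped_char X P (cball y 1) y t \<xi>)) / t"
  proof (rule eventually_at_right_less[THEN eventually_mono])
    fix t :: real assume "0 < t"
    then show "0 \<le> (1 - Re (stopped_char X P (cball y 1) y t \<xi>)) / t"
      using order_trans[OF complex_Re_le_cmod norm_stopped_char_le_1] by simp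
  qed
qed simp

text \<open>
  Condition (A) controls the frequencies in the unit ball; the inequality
  \<open>1 - cos (k u) \<le> k\<^sup>2 (1 - cos u)\<close> carries the bound over to all others.
\<close>

lemma has_symbol_Re_quadratic:
  assumes q: "has_symbol X P q" and A: "condition_A X P q x \<delta>' R'" and "0 < R'" "0 < \<delta>'"
  obtains C where "0 \<le> C" "\<And>\<xi>. Re (q x \<xi>) \<le> C * (norm \<xi> + 1)\<^sup>2"
proof -
  define R where "R = R' / 2"
  have R: "0 < R" "R < R'"
    using \<open>0 < R'\<close> by (auto simp: R_def)
  let ?B = "cball x \<delta>' \<times> cball (0 :: real ^ 'b) 1"
  have "bounded ((\<lambda>(y, \<xi>). Re (q y \<xi>)) ` ?B)"
    using A unfolding condition_A_def
    by (intro compact_imp_bounded compact_continuous_image compact_Times compact_cball) auto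
  then obtain C where C: "\<And>y \<xi>. (y, \<xi>) \<in> ?B \<Longrightarrow> \<bar>Re (q y \<xi>)\<bar> \<le> C"
    by (force simp: bounded_iff)
  obtain h0 where h0: "0 < h0"
    and meas: "\<And>h y. 0 < h \<Longrightarrow> h < h0 \<Longrightarrow> y \<in> cball x \<delta>' \<Longrightarrow> stopped_at_ball y R h \<in> borel_measurable (P y)"
    and bound: "\<And>h y \<xi>. 0 < h \<Longrightarrow> h < h0 \<Longrightarrow> y \<in> cball x \<delta>' \<Longrightarrow> norm \<xi> \<le> 1 \<Longrightarrow>
      \<bar>(\<integral>\<omega>. 1 - cos ((stopped_at_ball y R h \<omega> - y) \<bullet> \<xi>) \<partial>P y) - h * Re (q y \<xi>)\<bar> \<le> h"
    using condition_A_small_time[OF A R zero_less_one] by blast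
  have x: "x \<in> cball x \<delta>'"
    using \<open>0 < \<delta>'\<close> by simp
  interpret P: prob_space "P x"
    by (rule prob_space_P)
  have C0: "0 \<le> C"
    using C[of x 0] x by simp
  show thesis
  proof (rule that[of "C + 1"])
    fix \<xi> :: "real ^ 'b"
    \<comment> \<open>The value \<open>1\<close> at \<open>\<xi> = 0\<close> keeps \<open>k\<close>
      positive; otherwise \<open>k\<close> is the least integer with \<open>\<xi> / k\<close> in the
      unit ball.\<close>
    define k where "k = (if \<xi> = 0 then 1 else nat \<lceil>norm \<xi>\<rceil>)"
    have k: "norm \<xi> \<le> real k" "real k \<le> norm \<xi> + 1" "0 < real k"
      unfolding k_def by (auto simp: of_nat_ceiling)
    define \<eta> where "\<eta> = (1 / real k) *\<^sub>R \<xi>"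
    have \<eta>: "norm \<eta> \<le> 1" "\<xi> = real k *\<^sub>R \<eta>"
      using k by (auto simp: \<eta>_def)
    \<comment> \<open>The large frequency \<open>\<xi>\<close> is reached through the limit defining
      the symbol, while the uniform estimate is applied only at \<open>\<eta>\<close>; thus
      \<open>h0\<close> does not depend on \<open>\<xi>\<close>.\<close>
    have "Re (q x \<xi>) \<le> (real k)\<^sup>2 * (C + 1)"
    proof (rule tendsto_upperbound[OF has_symbol_Re[OF q R(1)]])
      have "(1 - Re (stopped_char X P (cball x R) x h \<xi>)) / h \<le> (real k)\<^sup>2 * (C + 1)"
        if h: "0 < h" "h < h0" for h
      proof -
        let ?Z = "stopped_at_ball x R h"
        note [measurable] = meas[OF h x]
        have bnd: "norm (1 - cos u) \<le> 2" for u :: real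
          using cos_ge_minus_one[of u] by simp
        have int: "integrable (P x) (\<lambda>\<omega>. 1 - cos ((?Z \<omega> - x) \<bullet> \<zeta>))" for \<zeta>
          by (rule P.integrable_const_bound[where B = 2], intro AE_I2 bnd, measurable)
        have int_cis: "integrable (P x) (\<lambda>\<omega>. cis ((?Z \<omega> - x) \<bullet> \<xi>))"
          by (rule P.integrable_const_bound[where B = 1]) (auto simp: cis_conv_exp)
        have "1 - Re (stopped_char X P (cball x R) x h \<xi>) = (\<integral>\<omega>. 1 - cos ((?Z \<omega> - x) \<bullet> \<xi>) \<partial>P x)"
          using integrable_Re[OF int_cis] integral_Re[OF int_cis, symmetric]
          by (simp add: stopped_char_eq P.prob_space)
        also have "\<dots> \<le> (\<integral>\<omega>. (real k)\<^sup>2 * (1 - cos ((?Z \<omega> - x) \<bullet> \<eta>)) \<partial>P x)"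
        proof (rule integral_mono[OF int integrable_mult_right[OF int]])
          fix \<omega>
          show "1 - cos ((?Z \<omega> - x) \<bullet> \<xi>) \<le> (real k)\<^sup>2 * (1 - cos ((?Z \<omega> - x) \<bullet> \<eta>))"
            unfolding \<eta>(2) inner_scaleR_right by (rule one_minus_cos_nat_mult_le)
        qed
        also have "\<dots> = (real k)\<^sup>2 * (\<integral>\<omega>. 1 - cos ((?Z \<omega> - x) \<bullet> \<eta>) \<partial>P x)"
          by (rule integral_mult_right_zero)
        also have "\<dots> \<le> (real k)\<^sup>2 * (h * (C + 1))"
        proof (intro mult_left_mono)
          have "(\<integral>\<omega>. 1 - cos ((?Z \<omega> - x) \<bullet> \<eta>) \<partial>P x) \<le> h * Re (q x \<eta>) + h"
            using bound[OF h x \<eta>(1)] by linarith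
          also have "\<dots> \<le> h * C + h"
            using C[of x \<eta>] x \<eta>(1) h by (intro add_mono mult_left_mono) auto
          finally show "(\<integral>\<omega>. 1 - cos ((?Z \<omega> - x) \<bullet> \<eta>) \<partial>P x) \<le> h * (C + 1)"
            by (simp add: distrib_left)
        qed simp
        finally show ?thesis
          using h by (simp add: field_simps)
      qed
      then show "\<forall>\<^sub>F h in at_right 0. (1 - Re (stopped_char X P (cball x R) x h \<xi>)) / h \<le> (real k)\<^sup>2 * (C + 1)"
        using h0 by (auto simp: eventually_at_right_field)
    qed simp
    also have "\<dots> \<le> (norm \<xi> + 1)\<^sup>2 * (C + 1)"
      using k C0 by (intro mult_right_mono power_mono) auto
    finally show "Re (q x \<xi>) \<le> (C + 1) * (norm \<xi> + 1)\<^sup>2"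
      by (simp add: mult.commute)
  qed (use C0 in simp)
qed

text \<open>Quadratic growth bounds the spot index at the centre \<open>x\<close>, and
  \<open>x\<close> lies in every ball over which an infimum is taken. The bound is what yields
  \<open>lam \<le> 2\<close>, needed to compare \<open>1 - cos\<close> with a power.\<close>

lemma local_index_le_2:
  assumes q: "has_symbol X P q" and A: "condition_A X P q x \<delta>' R'" and pos: "0 < R'" "0 < \<delta>'"
  shows "local_index q x \<le> 2"
proof -
  obtain C where C: "0 \<le> C" "\<And>\<xi>. Re (q x \<xi>) \<le> C * (norm \<xi> + 1)\<^sup>2"
    using has_symbol_Re_quadratic[OF q A pos] by blast
  have "spot_index q x \<le> ereal (2 + e)" if e: "0 < e" for e
    unfolding spot_index_def
  proof (rule INF_lower, safe)
    show "((\<lambda>\<xi>. norm \<xi> powr - (2 + e) * Re (q x \<xi>)) \<longlongrightarrow> 0) at_infinity"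
    proof (rule tendsto_norm_powr_times_0[OF has_symbol_Re_nonneg[OF q]])
      fix \<xi> :: "real ^ 'b" assume "1 \<le> norm \<xi>"
      then have "Re (q x \<xi>) \<le> C * (norm \<xi> + norm \<xi>)\<^sup>2"
        using C(1) by (intro order_trans[OF C(2)] mult_left_mono power_mono) auto
      then show "Re (q x \<xi>) \<le> 4 * C * norm \<xi> powr 2"
        using \<open>1 \<le> norm \<xi>\<close> by (simp add: power2_eq_square)
    qed (use e in simp)
  qed (use e in simp)
  then have "spot_index q x \<le> ereal 2 + ereal e" if "0 < e" for e
    using that by simp
  then have "spot_index q x \<le> ereal 2"
    by (rule ereal_le_epsilon2)
  then have "spot_index q x \<le> 2"
    by simp
  moreover have "(INF y \<in> cball x r. spot_index q y) \<le> spot_index q x" if "0 < r" for r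
    using that by (intro INF_lower) auto
  ultimately show ?thesis
    unfolding local_index_def by (intro SUP_least) (auto intro: order_trans)
qed

end

section \<open>Uniform partitions and the Markov property along them\<close>

text \<open>Partitions in \<open>p_variation\<close> must end exactly at \<open>T\<close>, so a sum
  over an initial stretch is first padded with the remaining uniform increments, which are
  nonnegative.\<close>

lemma p_variation_ge_uniform_sum:
  fixes g :: "real \<Rightarrow> 'b::real_normed_vector"
  assumes h: "0 < h" and T: "T = real m * h" and n: "n \<le> m"
  shows "(\<Sum>j<n. ennreal (norm (g (real (Suc j) * h) - g (real j * h)) powr p)) \<le> p_variation p g 0 T"
proof -
  have "(\<Sum>j<n. ennreal (norm (g (real (Suc j) * h) - g (real j * h)) powr p)) \<le>
      (\<Sum>j<m. ennreal (norm (g (real (Suc j) * h) - g (real j * h)) powr p))"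
    using n by (intro sum_mono2) auto
  also have "\<dots> = (\<Sum>j=1..m. ennreal (norm (g (real j * h) - g (real (j - 1) * h)) powr p))"
    by (rule sum.reindex_bij_witness[where i = "\<lambda>j. j - 1" and j = Suc]) auto
  also have "\<dots> \<le> p_variation p g 0 T"
    unfolding p_variation_def
    by (rule SUP_upper2[of "(m, \<lambda>j. real j * h)"]) (use h T in auto)
  finally show ?thesis .
qed

context hunt_process
begin

lemma transition_kernel:
  assumes "0 \<le> h"
  shows "(\<lambda>y. distr (P y) borel (X h)) \<in> borel \<rightarrow>\<^sub>M prob_algebra borel"
proof (rule measurable_prob_algebraI)
  note [measurable] = measurable_X[OF assms]
  show prob: "prob_space (distr (P y) borel (X h))" for y
    by (rule prob_space.prob_space_distr[OF prob_space_P]) measurable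
  show "(\<lambda>y. distr (P y) borel (X h)) \<in> borel \<rightarrow>\<^sub>M subprob_algebra borel"
  proof (rule measurable_subprob_algebra)
    fix A :: "(real ^ 'b) set" assume A: "A \<in> sets borel"
    have "emeasure (distr (P y) borel (X h)) A = ennreal (measure (P y) {\<omega> \<in> space M. X h \<omega> \<in> A})" for y
    proof -
      interpret P: prob_space "P y"
        by (rule prob_space_P)
      show ?thesis
        using A by (auto simp: emeasure_distr P.emeasure_eq_measure space_P vimage_def Int_def intro!: arg_cong[where f = P.prob])
    qed
    then show "(\<lambda>y. emeasure (distr (P y) borel (X h)) A) \<in> borel_measurable borel"
      using kernel[OF assms A] by simp
  qed (auto intro: prob_space_imp_subprob_space prob)
qed

text \<open>The Markov property speaks of \<open>real_cond_exp\<close>, but the weights are extended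
  nonnegative functions. For an indicator the negative part vanishes and \<open>nn_cond_exp\<close>
  is at most \<open>1\<close>, so the two conditional expectations agree almost everywhere and the
  integral identity of \<open>nn_cond_exp\<close> applies.\<close>

lemma markov_nn_integral_rectangle:
  assumes s: "0 \<le> s" and h: "0 \<le> h" and W: "W \<in> borel_measurable (F s)" and C: "C \<in> sets borel"
  shows "(\<integral>\<^sup>+ \<omega>. W \<omega> * indicator C (X (s + h) \<omega>) \<partial>P x) =
    (\<integral>\<^sup>+ \<omega>. W \<omega> * emeasure (distr (P (X s \<omega>)) borel (X h)) C \<partial>P x)"
proof -
  interpret P: prob_space "P x"
    by (rule prob_space_P)
  interpret finite_measure_subalgebra "P x" "F s"
    by unfold_locales (rule subalgebra_F[OF s])
  have [measurable]: "X (s + h) \<in> borel_measurable (P x)" "X h \<in> borel_measurable (P z)" for z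
    using measurable_X[of "s + h"] measurable_X[of h] s h by auto
  let ?I = "indicator {\<omega> \<in> space M. X (s + h) \<omega> \<in> C} :: 'a \<Rightarrow> real"
  have E: "{\<omega> \<in> space M. X (s + h) \<omega> \<in> C} \<in> sets (P x)"
    using C unfolding space_P[of x, symmetric] by measurable
  have I_meas [measurable]: "(\<lambda>\<omega>. ennreal (?I \<omega>)) \<in> borel_measurable (P x)"
    by (rule measurable_compose[OF borel_measurable_indicator[OF E] measurable_ennreal])
  have "AE \<omega> in P x. nn_cond_exp (P x) (F s) (\<lambda>\<omega>. ennreal (?I \<omega>)) \<omega> \<le> nn_cond_exp (P x) (F s) (\<lambda>_. 1) \<omega>"
    by (rule nn_cond_exp_mono[OF AE_I2 I_meas]) (auto split: split_indicator)
  moreover have "AE \<omega> in P x. 1 = nn_cond_exp (P x) (F s) (\<lambda>_. 1) \<omega>"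
    by (rule nn_cond_exp_F_meas) measurable
  moreover have "AE \<omega> in P x. 0 = nn_cond_exp (P x) (F s) (\<lambda>_. 0) \<omega>"
    by (rule nn_cond_exp_F_meas) measurable
  ultimately have "AE \<omega> in P x. nn_cond_exp (P x) (F s) (\<lambda>\<omega>. ennreal (?I \<omega>)) \<omega> = ennreal (real_cond_exp (P x) (F s) ?I \<omega>)"
  proof eventually_elim
    case (elim \<omega>)
    have "(\<lambda>\<omega>. ennreal (- ?I \<omega>)) = (\<lambda>_. 0)"
      by (auto simp: ennreal_neg)
    moreover have "nn_cond_exp (P x) (F s) (\<lambda>\<omega>. ennreal (?I \<omega>)) \<omega> < \<top>"
      using elim le_less_trans[OF _ ennreal_one_less_top] by simp
    ultimately show ?case
      using elim by (simp add: real_cond_exp_def)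
  qed
  then have ae: "AE \<omega> in P x. nn_cond_exp (P x) (F s) (\<lambda>\<omega>. ennreal (?I \<omega>)) \<omega> = emeasure (distr (P (X s \<omega>)) borel (X h)) C"
    using markov[OF s h C, of x]
  proof eventually_elim
    case (elim \<omega>)
    interpret Q: prob_space "P (X s \<omega>)"
      by (rule prob_space_P)
    show ?case
      using elim C by (auto simp: emeasure_distr Q.emeasure_eq_measure space_P vimage_def Int_def intro!: arg_cong[where f = Q.prob])
  qed
  have "(\<integral>\<^sup>+ \<omega>. W \<omega> * indicator C (X (s + h) \<omega>) \<partial>P x) = (\<integral>\<^sup>+ \<omega>. W \<omega> * ennreal (?I \<omega>) \<partial>P x)"
    by (intro nn_integral_cong) (auto simp: space_P split: split_indicator)
  also have "\<dots> = (\<integral>\<^sup>+ \<omega>. W \<omega> * nn_cond_exp (P x) (F s) (\<lambda>\<omega>. ennreal (?I \<omega>)) \<omega> \<partial>P x)"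
    by (rule nn_cond_exp_intg[OF W I_meas, symmetric])
  also have "\<dots> = (\<integral>\<^sup>+ \<omega>. W \<omega> * emeasure (distr (P (X s \<omega>)) borel (X h)) C \<partial>P x)"
    using ae by (intro nn_integral_cong_AE) auto
  finally show ?thesis .
qed

text \<open>Both sides integrate \<open>g\<close> against a law on pairs: that of
  \<open>(X s, X (s + h))\<close>, and that of \<open>X s\<close> followed by one step of the
  kernel, with \<open>W\<close> absorbed as a density. These agree on rectangles, hence everywhere;
  \<open>W \<le> 1\<close> makes them finite, as the uniqueness theorem for measures
  requires.\<close>

lemma markov_nn_integral:
  assumes s: "0 \<le> s" and h: "0 \<le> h"
    and W [measurable]: "W \<in> borel_measurable (F s)" and W1: "\<And>\<omega>. W \<omega> \<le> 1"
    and g [measurable]: "g \<in> borel_measurable (borel \<Otimes>\<^sub>M borel)"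
  shows "(\<integral>\<^sup>+ \<omega>. W \<omega> * g (X s \<omega>, X (s + h) \<omega>) \<partial>P x) =
    (\<integral>\<^sup>+ \<omega>. W \<omega> * (\<integral>\<^sup>+ \<omega>'. g (X s \<omega>, X h \<omega>') \<partial>P (X s \<omega>)) \<partial>P x)"
proof -
  interpret P: prob_space "P x"
    by (rule prob_space_P)
  let ?\<mu> = "density (P x) W"
  let ?B = "borel \<Otimes>\<^sub>M borel :: ((real ^ 'b) \<times> (real ^ 'b)) measure"
  let ?K = "\<lambda>y. distr (P y) borel (X h)"
  let ?J = "\<lambda>y. ?K y \<bind> (\<lambda>z. return ?B (y, z))"
  have W_M [measurable]: "W \<in> borel_measurable (P x)"
    using W measurable_from_subalg[OF subalgebra_F[OF s]] by blast
  have X_P [measurable]: "X t \<in> borel_measurable (P y)" if "0 \<le> t" for t y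
    using measurable_X[OF that] by simp
  have [measurable]: "X s \<in> borel_measurable (P y)" "X (s + h) \<in> borel_measurable (P y)" "X h \<in> borel_measurable (P y)" for y
    using s h by auto
  have K [measurable]: "?K \<in> borel \<rightarrow>\<^sub>M prob_algebra borel"
    by (rule transition_kernel[OF h])
  have J [measurable]: "?J \<in> borel \<rightarrow>\<^sub>M prob_algebra ?B"
    by measurable
  have J_int: "(\<integral>\<^sup>+ p. f p \<partial>?J y) = (\<integral>\<^sup>+ z. f (y, z) \<partial>?K y)" if [measurable]: "f \<in> borel_measurable ?B" for f y
    by (subst nn_integral_bind[where B = ?B]) (auto simp: nn_integral_return space_pair_measure)
  have JX [measurable]: "(\<lambda>\<omega>. ?J (X s \<omega>)) \<in> ?\<mu> \<rightarrow>\<^sub>M subprob_algebra ?B"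
    by (rule measurable_prob_algebraD) measurable
  have sets_bind_J: "sets (?\<mu> \<bind> (\<lambda>\<omega>. ?J (X s \<omega>))) = sets ?B"
    by (rule sets_bind) (auto simp: P.not_empty)
  have J_dens: "(\<integral>\<^sup>+ \<omega>. (\<integral>\<^sup>+ p. f p \<partial>?J (X s \<omega>)) \<partial>?\<mu>) = (\<integral>\<^sup>+ \<omega>. W \<omega> * (\<integral>\<^sup>+ z. f (X s \<omega>, z) \<partial>?K (X s \<omega>)) \<partial>P x)"
    if f: "f \<in> borel_measurable ?B" for f
  proof -
    have "(\<lambda>\<omega>. \<integral>\<^sup>+ p. f p \<partial>?J (X s \<omega>)) \<in> borel_measurable (P x)"
      using measurable_compose[OF JX nn_integral_measurable_subprob_algebra[OF f]] by simp
    then show ?thesis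
      by (simp add: nn_integral_density J_int[OF f])
  qed
  have eq: "distr ?\<mu> ?B (\<lambda>\<omega>. (X s \<omega>, X (s + h) \<omega>)) = ?\<mu> \<bind> (\<lambda>\<omega>. ?J (X s \<omega>))"
  proof (rule measure_eqI_generator_eq[where E = "{a \<times> b |a b. a \<in> sets borel \<and> b \<in> sets borel}" and \<Omega> = UNIV and A = "\<lambda>_. UNIV"])
    fix D :: "((real ^ 'b) \<times> (real ^ 'b)) set"
    assume "D \<in> {a \<times> b |a b. a \<in> sets borel \<and> b \<in> sets borel}"
    then obtain A C where D: "D = A \<times> C" and [measurable]: "A \<in> sets borel" "C \<in> sets borel"
      by auto
    have "emeasure (distr ?\<mu> ?B (\<lambda>\<omega>. (X s \<omega>, X (s + h) \<omega>))) D =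
        (\<integral>\<^sup>+ p. indicator D p \<partial>distr ?\<mu> ?B (\<lambda>\<omega>. (X s \<omega>, X (s + h) \<omega>)))"
      by (subst nn_integral_indicator) (auto simp: D)
    also have "\<dots> = (\<integral>\<^sup>+ \<omega>. (W \<omega> * indicator A (X s \<omega>)) * indicator C (X (s + h) \<omega>) \<partial>P x)"
      unfolding D by (simp add: nn_integral_distr nn_integral_density indicator_times mult.assoc)
    also have "\<dots> = (\<integral>\<^sup>+ \<omega>. (W \<omega> * indicator A (X s \<omega>)) * emeasure (?K (X s \<omega>)) C \<partial>P x)"
    proof (intro markov_nn_integral_rectangle s h)
      show "(\<lambda>\<omega>. W \<omega> * indicator A (X s \<omega>)) \<in> borel_measurable (F s)"
        by (intro borel_measurable_times_ennreal W measurable_compose[OF adapted[OF s]]) measurable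
    qed measurable
    also have "\<dots> = (\<integral>\<^sup>+ \<omega>. (\<integral>\<^sup>+ p. indicator D p \<partial>?J (X s \<omega>)) \<partial>?\<mu>)"
      by (subst J_dens) (auto simp: D indicator_times nn_integral_cmult mult.assoc)
    also have "\<dots> = (\<integral>\<^sup>+ p. indicator D p \<partial>(?\<mu> \<bind> (\<lambda>\<omega>. ?J (X s \<omega>))))"
      by (subst nn_integral_bind[OF _ JX]) (auto simp: D)
    also have "\<dots> = emeasure (?\<mu> \<bind> (\<lambda>\<omega>. ?J (X s \<omega>))) D"
      by (rule nn_integral_indicator) (simp add: D sets_bind_J)
    finally show "emeasure (distr ?\<mu> ?B (\<lambda>\<omega>. (X s \<omega>, X (s + h) \<omega>))) D = emeasure (?\<mu> \<bind> (\<lambda>\<omega>. ?J (X s \<omega>))) D" .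
  next
    show "emeasure (distr ?\<mu> ?B (\<lambda>\<omega>. (X s \<omega>, X (s + h) \<omega>))) UNIV \<noteq> \<infinity>"
    proof -
      have "emeasure (distr ?\<mu> ?B (\<lambda>\<omega>. (X s \<omega>, X (s + h) \<omega>))) UNIV = (\<integral>\<^sup>+ \<omega>. W \<omega> \<partial>P x)"
        using sets.top[of ?B] by (subst emeasure_distr) (auto simp: space_pair_measure emeasure_density intro!: nn_integral_cong)
      also have "\<dots> \<le> (\<integral>\<^sup>+ \<omega>. 1 \<partial>P x)"
        by (intro nn_integral_mono W1)
      finally show ?thesis
        by (auto simp: P.emeasure_space_1 top_unique)
    qed
  next
    show "range (\<lambda>_. UNIV) \<subseteq> {a \<times> b |a b. a \<in> sets (borel :: (real ^ 'b) measure) \<and> b \<in> sets (borel :: (real ^ 'b) measure)}"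
      by (auto intro!: exI[of _ UNIV])
  qed (auto simp: Int_stable_pair_measure_generator sets_pair_measure sets_bind_J)
  have "(\<integral>\<^sup>+ \<omega>. W \<omega> * g (X s \<omega>, X (s + h) \<omega>) \<partial>P x) =
      (\<integral>\<^sup>+ p. g p \<partial>distr ?\<mu> ?B (\<lambda>\<omega>. (X s \<omega>, X (s + h) \<omega>)))"
    by (simp add: nn_integral_distr nn_integral_density)
  also have "\<dots> = (\<integral>\<^sup>+ \<omega>. (\<integral>\<^sup>+ p. g p \<partial>?J (X s \<omega>)) \<partial>?\<mu>)"
    unfolding eq by (rule nn_integral_bind[OF g JX])
  also have "\<dots> = (\<integral>\<^sup>+ \<omega>. W \<omega> * (\<integral>\<^sup>+ \<omega>'. g (X s \<omega>, X h \<omega>') \<partial>P (X s \<omega>)) \<partial>P x)"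
    by (simp add: J_dens nn_integral_distr)
  finally show ?thesis .
qed

text \<open>Conditioning at time \<open>n * h\<close> peels off the last factor: the earlier ones
  are measurable there, and the last has conditional expectation at most \<open>c\<close> whatever
  the current state.\<close>

lemma nn_integral_prod_increments_le:
  assumes h: "0 \<le> h" and g [measurable]: "g \<in> borel_measurable (borel \<Otimes>\<^sub>M borel)" and g1: "\<And>p. g p \<le> 1"
    and c: "\<And>y. (\<integral>\<^sup>+ \<omega>. g (y, X h \<omega>) \<partial>P y) \<le> c"
  shows "(\<integral>\<^sup>+ \<omega>. (\<Prod>j<n. g (X (real j * h) \<omega>, X (real (Suc j) * h) \<omega>)) \<partial>P x) \<le> c ^ n"
proof (induction n)
  case 0
  show ?case
    using prob_space.emeasure_space_1[OF prob_space_P] by simp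
next
  case (Suc n)
  let ?W = "\<lambda>\<omega>. \<Prod>j<n. g (X (real j * h) \<omega>, X (real (Suc j) * h) \<omega>)"
  have X_F: "X (real j * h) \<in> borel_measurable (F (real n * h))" if "j \<le> n" for j
  proof -
    have "real j * h \<le> real n * h"
      using that h by (intro mult_right_mono) auto
    then show ?thesis
      using h by (intro measurable_mono[OF order_refl refl sets_F_mono _, THEN subsetD, OF _ _ _ adapted])
        (auto simp: space_F)
  qed
  have W: "?W \<in> borel_measurable (F (real n * h))"
  proof (rule borel_measurable_prod_ennreal)
    fix j assume "j \<in> {..<n}"
    then show "(\<lambda>\<omega>. g (X (real j * h) \<omega>, X (real (Suc j) * h) \<omega>)) \<in> borel_measurable (F (real n * h))"
      by (intro measurable_compose[OF measurable_Pair g] X_F) auto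
  qed
  have [measurable]: "?W \<in> borel_measurable (P x)"
    by (rule measurable_from_subalg[OF subalgebra_F W]) (use h in simp)
  have "(\<integral>\<^sup>+ \<omega>. (\<Prod>j<Suc n. g (X (real j * h) \<omega>, X (real (Suc j) * h) \<omega>)) \<partial>P x) =
      (\<integral>\<^sup>+ \<omega>. ?W \<omega> * g (X (real n * h) \<omega>, X (real n * h + h) \<omega>) \<partial>P x)"
    by (simp add: distrib_right add.commute)
  also have "\<dots> = (\<integral>\<^sup>+ \<omega>. ?W \<omega> * (\<integral>\<^sup>+ \<omega>'. g (X (real n * h) \<omega>, X h \<omega>') \<partial>P (X (real n * h) \<omega>)) \<partial>P x)"
    using h by (intro markov_nn_integral W g prod_le_1 conjI g1) auto
  also have "\<dots> \<le> (\<integral>\<^sup>+ \<omega>. ?W \<omega> * c \<partial>P x)"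
    by (intro nn_integral_mono mult_left_mono c) auto
  also have "\<dots> = (\<integral>\<^sup>+ \<omega>. ?W \<omega> \<partial>P x) * c"
    by (rule nn_integral_multc) measurable
  also have "\<dots> \<le> c ^ n * c"
    by (intro mult_right_mono Suc) auto
  finally show ?case
    by (simp add: mult.commute)
qed

end

section \<open>From increment bounds to infinite variation\<close>

text \<open>After multiplication by \<open>exp t\<close> this follows from
  \<open>1 + t \<le> exp t\<close>, since \<open>t * t \<le> t\<close> on the unit interval.\<close>

lemma exp_minus_le: "0 \<le> t \<Longrightarrow> t \<le> 1 \<Longrightarrow> exp (- t) \<le> 1 - t / 2" for t :: real
proof -
  assume t: "0 \<le> t" "t \<le> 1"
  have "t * t \<le> t * 1"
    using t by (intro mult_left_mono) auto
  then have "1 \<le> (1 - t / 2) * (1 + t)"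
    by (simp add: field_simps)
  also have "\<dots> \<le> (1 - t / 2) * exp t"
    using t by (intro mult_left_mono) auto
  finally show ?thesis
    by (simp add: exp_minus field_simps)
qed

context hunt_process
begin

text \<open>
  At each \<open>y\<close> some frequency \<open>\<xi>\<close> has \<open>Re q(y, \<xi>)\<close> much larger than \<open>|\<xi>| powr lam\<close>; by continuity
  and compactness finitely many frequencies suffice, so one time scale \<open>h0\<close> serves the whole ball.
\<close>

lemma truncated_increment_lower_bound:
  assumes q: "has_symbol X P q" and A: "condition_A X P q x \<delta>' R'" and "0 < R'"
    and lam: "0 < lam" "lam \<le> 2" "lam < c" and r: "r \<le> \<delta>'"
    and spot: "\<And>y. y \<in> cball x r \<Longrightarrow> \<not> ((\<lambda>\<xi>. norm \<xi> powr (- c) * Re (q y \<xi>)) \<longlongrightarrow> 0) at_infinity"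
  shows "\<exists>h0>0. \<forall>h y. 0 < h \<longrightarrow> h < h0 \<longrightarrow> y \<in> cball x r \<longrightarrow>
    a * h \<le> (\<integral>\<omega>. min 1 (norm (X h \<omega> - y)) powr lam \<partial>P y)"
proof -
  obtain C where C: "\<And>\<Delta>. 0 < \<Delta> \<Longrightarrow> \<exists>h0>0. \<forall>h y \<xi>. 0 < h \<longrightarrow> h < h0 \<longrightarrow> y \<in> cball x \<delta>' \<longrightarrow> norm \<xi> \<le> \<Delta> \<longrightarrow>
      h * (Re (q y \<xi>) - C) \<le> (\<integral>\<omega>. 1 - cos ((X h \<omega> - y) \<bullet> \<xi>) \<partial>P y)"
    using condition_A_char_lower_bound[OF A \<open>0 < R'\<close>] by blast
  \<comment> \<open>The \<open>2\<close> comes from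
    \<open>1 - cos u \<le> 2 * min 1 \<bar>u\<bar> powr lam\<close>; the summand
    \<open>\<bar>C\<bar>\<close> absorbs \<open>C\<close>, because
    \<open>norm \<xi> powr lam \<ge> 1\<close> for the frequencies used.\<close>
  define b where "b = 2 * \<bar>a\<bar> + \<bar>C\<bar>"
  have "\<exists>T. open T \<and> {y \<in> cball x r. b * norm \<xi> powr lam < Re (q y \<xi>)} = cball x r \<inter> T" for \<xi>
  proof -
    \<comment> \<open>The radius \<open>norm \<xi> + 1\<close> is positive even for
      \<open>\<xi> = 0\<close>, as Condition (A) demands.\<close>
    have "continuous_on (cball x \<delta>' \<times> cball 0 (norm \<xi> + 1)) (\<lambda>(y, \<xi>). Re (q y \<xi>))"
      using A unfolding condition_A_def by (auto simp: add_nonneg_pos)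
    then have "continuous_on (cball x r) (\<lambda>y. (\<lambda>(y, \<xi>). Re (q y \<xi>)) (y, \<xi>))"
      by (rule continuous_on_compose2) (use r in \<open>auto intro!: continuous_intros\<close>)
    then have "openin (top_of_set (cball x r)) (cball x r \<inter> (\<lambda>y. Re (q y \<xi>)) -` {b * norm \<xi> powr lam <..})"
      by (intro continuous_openin_preimage_gen) auto
    then show ?thesis
      by (auto simp: openin_open vimage_def Int_def)
  qed
  then obtain U where U: "\<And>\<xi>. open (U \<xi>)" "\<And>\<xi>. {y \<in> cball x r. b * norm \<xi> powr lam < Re (q y \<xi>)} = cball x r \<inter> U \<xi>"
    by metis
  have "cball x r \<subseteq> (\<Union>\<xi>\<in>{\<xi>. 1 \<le> norm \<xi>}. U \<xi>)"
  proof
    fix y assume y: "y \<in> cball x r"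
    have "\<exists>\<xi>. 1 \<le> norm \<xi> \<and> b * norm \<xi> powr lam < Re (q y \<xi>)"
    proof (rule ccontr)
      assume "\<not> ?thesis"
      then have "((\<lambda>\<xi>. norm \<xi> powr (- c) * Re (q y \<xi>)) \<longlongrightarrow> 0) at_infinity"
        by (intro tendsto_norm_powr_times_0[of _ b lam] has_symbol_Re_nonneg[OF q] lam) (auto simp: not_less)
      then show False
        using spot[OF y] by simp
    qed
    then show "y \<in> (\<Union>\<xi>\<in>{\<xi>. 1 \<le> norm \<xi>}. U \<xi>)"
      using U(2) y by blast
  qed
  then obtain \<Xi> where \<Xi>: "\<Xi> \<subseteq> {\<xi>. 1 \<le> norm \<xi>}" "finite \<Xi>" "cball x r \<subseteq> (\<Union>\<xi>\<in>\<Xi>. U \<xi>)"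
    by (rule compactE_image[OF compact_cball U(1)])
  define \<Delta> where "\<Delta> = Max (insert 1 (norm ` \<Xi>))"
  have \<Delta>: "1 \<le> \<Delta>" "\<And>\<xi>. \<xi> \<in> \<Xi> \<Longrightarrow> norm \<xi> \<le> \<Delta>"
    using \<Xi>(2) by (auto simp: \<Delta>_def)
  have "0 < \<Delta>"
    using \<Delta>(1) by simp
  from C[OF this] obtain h0 where h0: "0 < h0"
    and bound: "\<And>h y \<xi>. 0 < h \<Longrightarrow> h < h0 \<Longrightarrow> y \<in> cball x \<delta>' \<Longrightarrow> norm \<xi> \<le> \<Delta> \<Longrightarrow>
      h * (Re (q y \<xi>) - C) \<le> (\<integral>\<omega>. 1 - cos ((X h \<omega> - y) \<bullet> \<xi>) \<partial>P y)"
    by blast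
  have "a * h \<le> (\<integral>\<omega>. min 1 (norm (X h \<omega> - y)) powr lam \<partial>P y)"
    if h: "0 < h" "h < h0" and y: "y \<in> cball x r" for h y
  proof -
    interpret P: prob_space "P y"
      by (rule prob_space_P)
    have [measurable]: "X h \<in> borel_measurable (P y)"
      using h measurable_X[of h] by simp
    obtain \<xi> where \<xi>: "\<xi> \<in> \<Xi>" "y \<in> U \<xi>"
      using \<Xi>(3) y by auto
    then have q_gt: "b * norm \<xi> powr lam < Re (q y \<xi>)" and \<xi>1: "1 \<le> norm \<xi>"
      using U(2)[of \<xi>] y \<Xi>(1) by auto
    have powr1: "1 \<le> norm \<xi> powr lam"
      using \<xi>1 lam by (intro ge_one_powr_ge_zero) auto
    have pointwise: "1 - cos (z \<bullet> \<xi>) \<le> 2 * norm \<xi> powr lam * min 1 (norm z) powr lam" for z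
    proof -
      have "1 - cos (z \<bullet> \<xi>) \<le> 2 * min 1 \<bar>z \<bullet> \<xi>\<bar> powr lam"
        by (rule one_minus_cos_le_powr) (use lam in auto)
      \<comment> \<open>The restriction to \<open>1 \<le> norm \<xi>\<close> is used here: it lets
        \<open>norm \<xi>\<close> be pulled out of the truncation.\<close>
      also have "min 1 \<bar>z \<bullet> \<xi>\<bar> \<le> norm \<xi> * min 1 (norm z)"
        using Cauchy_Schwarz_ineq2[of z \<xi>] \<xi>1 by (auto simp: min_def mult.commute)
      then have "2 * min 1 \<bar>z \<bullet> \<xi>\<bar> powr lam \<le> 2 * (norm \<xi> * min 1 (norm z)) powr lam"
        using lam by (intro mult_left_mono powr_mono2) auto
      finally show ?thesis
        by (simp add: powr_mult)
    qed
    have bnd: "norm (1 - cos u) \<le> 2" for u :: real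
      using cos_ge_minus_one[of u] by simp
    have int: "integrable (P y) (\<lambda>\<omega>. 1 - cos ((X h \<omega> - y) \<bullet> \<xi>))"
      by (rule P.integrable_const_bound[where B = 2], intro AE_I2 bnd, measurable)
    have int': "integrable (P y) (\<lambda>\<omega>. min 1 (norm (X h \<omega> - y)) powr lam)"
      using lam by (intro P.integrable_const_bound[where B = 1] AE_I2) (auto intro!: powr_le1)
    have "2 * norm \<xi> powr lam * (a * h) \<le> h * (b * norm \<xi> powr lam - \<bar>C\<bar> * norm \<xi> powr lam)"
      using h(1) mult_right_mono[of a "\<bar>a\<bar>" "norm \<xi> powr lam"] by (simp add: b_def algebra_simps)
    also have "\<dots> \<le> h * (Re (q y \<xi>) - C)"
    proof (intro mult_left_mono diff_mono)
      have "C \<le> \<bar>C\<bar> * 1"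
        by simp
      also have "\<dots> \<le> \<bar>C\<bar> * norm \<xi> powr lam"
        using powr1 by (intro mult_left_mono) auto
      finally show "C \<le> \<bar>C\<bar> * norm \<xi> powr lam" .
    qed (use q_gt h in auto)
    also have "\<dots> \<le> (\<integral>\<omega>. 1 - cos ((X h \<omega> - y) \<bullet> \<xi>) \<partial>P y)"
      using \<Delta>(2) \<xi>(1) y r by (intro bound h) auto
    also have "\<dots> \<le> (\<integral>\<omega>. 2 * norm \<xi> powr lam * min 1 (norm (X h \<omega> - y)) powr lam \<partial>P y)"
      by (intro integral_mono int integrable_mult_right int' pointwise)
    also have "\<dots> = 2 * norm \<xi> powr lam * (\<integral>\<omega>. min 1 (norm (X h \<omega> - y)) powr lam \<partial>P y)"
      by simp
    finally show ?thesis
      by (rule mult_left_le_imp_le) (use powr1 in linarith)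
  qed
  then show ?thesis
    using h0 by blast
qed

text \<open>
  With \<open>V\<close> the sum of the \<open>n\<close> truncated increments of mesh \<open>h\<close>, the Markov property bounds the
  expectation of \<open>exp (- V)\<close> on staying in the ball by \<open>exp (- a n h / 2)\<close>, where \<open>a\<close> is
  arbitrary while \<open>n h\<close> is fixed. So \<open>V\<close> is unbounded on every initial interval spent in the ball.
\<close>

lemma AE_p_variation_eq_top:
  assumes start: "measure (P x) {\<omega> \<in> space M. X 0 \<omega> = x} = 1" and "0 < T" "0 < lam" "0 < r"
    and incr: "\<And>a. \<exists>h0>0. \<forall>h y. 0 < h \<longrightarrow> h < h0 \<longrightarrow> y \<in> cball x r \<longrightarrow>
      a * h \<le> (\<integral>\<omega>. min 1 (norm (X h \<omega> - y)) powr lam \<partial>P y)"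
  shows "AE \<omega> in P x. p_variation lam (\<lambda>t. X t \<omega>) 0 T = \<top>"
proof -
  interpret P: prob_space "P x"
    by (rule prob_space_P)
  define Y :: "real ^ 'b \<Rightarrow> real ^ 'b \<Rightarrow> real" where "Y y z = min 1 (norm (z - y)) powr lam" for y z
  \<comment> \<open>The indicator tests only the left endpoint: outside the ball the factor is
    \<open>0\<close>, so its integral satisfies the one-step bound trivially.\<close>
  define g :: "(real ^ 'b) \<times> (real ^ 'b) \<Rightarrow> ennreal"
    where "g = (\<lambda>(y, z). indicator (cball x r) y * ennreal (exp (- Y y z)))"
  \<comment> \<open>\<open>Suc n\<close> steps of this mesh cover the initial interval of length
    \<open>T / Suc m\<close>, and \<open>Suc m * Suc n\<close> steps end exactly at
    \<open>T\<close>.\<close>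
  define h where "h m n = T / (real (Suc m) * real (Suc n))" for m n
  define f where "f m n \<omega> = (\<Prod>j<Suc n. g (X (real j * h m n) \<omega>, X (real (Suc j) * h m n) \<omega>))" for m n \<omega>
  have Y01: "0 \<le> Y y z" "Y y z \<le> 1" for y z
    using \<open>0 < lam\<close> by (auto simp: Y_def intro!: powr_le1)
  have [measurable]: "(\<lambda>z. Y y z) \<in> borel_measurable borel" for y
    unfolding Y_def by measurable
  have g_meas [measurable]: "g \<in> borel_measurable (borel \<Otimes>\<^sub>M borel)"
  proof -
    have "(\<lambda>p :: (real ^ 'b) \<times> (real ^ 'b). exp (- Y (fst p) (snd p))) \<in> borel_measurable (borel \<Otimes>\<^sub>M borel)"
      unfolding Y_def by measurable
    moreover have "(\<lambda>p :: (real ^ 'b) \<times> (real ^ 'b). indicator (cball x r) (fst p) :: ennreal) \<in> borel_measurable (borel \<Otimes>\<^sub>M borel)"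
      by (intro measurable_compose[OF measurable_fst] borel_measurable_indicator) simp
    ultimately show ?thesis
      unfolding g_def case_prod_beta by (intro borel_measurable_times_ennreal measurable_compose[OF _ measurable_ennreal])
  qed
  have g1: "g p \<le> 1" for p
    using Y01 by (auto simp: g_def split: prod.split split_indicator)
  have h: "0 < h m n" for m n
    using \<open>0 < T\<close> by (simp add: h_def)
  have h_lim: "h m \<longlonglongrightarrow> 0" for m
  proof -
    have "(\<lambda>n. (T / real (Suc m)) / real (Suc n)) \<longlonglongrightarrow> 0"
      by (rule LIMSEQ_Suc[OF lim_const_over_n])
    moreover have "h m = (\<lambda>n. (T / real (Suc m)) / real (Suc n))"
      by (rule ext) (simp add: h_def)
    ultimately show ?thesis
      by simp
  qed
  have f_meas [measurable]: "f m n \<in> borel_measurable (P x)" for m n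
  proof -
    have "X (real j * h m n) \<in> borel_measurable (P x)" for j
      using measurable_X[of "real j * h m n"] h[of m n] by simp
    then show ?thesis
      unfolding f_def by (intro borel_measurable_prod_ennreal measurable_compose[OF measurable_Pair g_meas])
  qed
  have f_le: "\<forall>\<^sub>F n in sequentially. (\<integral>\<^sup>+ \<omega>. f m n \<omega> \<partial>P x) \<le> ennreal (exp (- (a * T / (2 * real (Suc m)))))" for m a
  proof -
    obtain h0 where h0: "0 < h0" and ge: "\<And>h y. 0 < h \<Longrightarrow> h < h0 \<Longrightarrow> y \<in> cball x r \<Longrightarrow>
        a * h \<le> (\<integral>\<omega>. Y y (X h \<omega>) \<partial>P y)"
      using incr[of a] unfolding Y_def by blast
    have "\<forall>\<^sub>F n in sequentially. h m n < h0"
      using h_lim h0 by (rule order_tendstoD)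
    then show ?thesis
    proof eventually_elim
      case (elim n)
      let ?h = "h m n"
      have "(\<integral>\<^sup>+ \<omega>. g (y, X ?h \<omega>) \<partial>P y) \<le> ennreal (exp (- (a * ?h / 2)))" for y
      proof (cases "y \<in> cball x r")
        case True
        interpret Q: prob_space "P y"
          by (rule prob_space_P)
        have [measurable]: "X ?h \<in> borel_measurable (P y)"
          using measurable_X[of ?h] h[of m n] by simp
        have int: "integrable (P y) (\<lambda>\<omega>. Y y (X ?h \<omega>))"
          using Y01 by (intro Q.integrable_const_bound[where B = 1]) auto
        have "(\<integral>\<^sup>+ \<omega>. g (y, X ?h \<omega>) \<partial>P y) \<le> (\<integral>\<^sup>+ \<omega>. ennreal (1 - Y y (X ?h \<omega>) / 2) \<partial>P y)"
          using True by (intro nn_integral_mono) (auto simp: g_def intro!: ennreal_leI exp_minus_le Y01)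
        also have "\<dots> = ennreal (\<integral>\<omega>. 1 - Y y (X ?h \<omega>) / 2 \<partial>P y)"
        proof (intro nn_integral_eq_integral AE_I2)
          fix \<omega> show "0 \<le> 1 - Y y (X ?h \<omega>) / 2"
            using Y01(2)[of y "X ?h \<omega>"] by simp
        qed (use int in simp)
        also have "(\<integral>\<omega>. 1 - Y y (X ?h \<omega>) / 2 \<partial>P y) = 1 - (\<integral>\<omega>. Y y (X ?h \<omega>) \<partial>P y) / 2"
          using int by (simp add: Q.prob_space)
        also have "\<dots> \<le> 1 + (- (a * ?h / 2))"
          using ge[OF h elim True] by simp
        also have "\<dots> \<le> exp (- (a * ?h / 2))"
          by (rule exp_ge_add_one_self)
        finally show ?thesis
          by (simp add: ennreal_leI)
      qed (simp add: g_def)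
      then have "(\<integral>\<^sup>+ \<omega>. f m n \<omega> \<partial>P x) \<le> ennreal (exp (- (a * ?h / 2))) ^ Suc n"
        unfolding f_def by (rule nn_integral_prod_increments_le[OF less_imp_le[OF h] g_meas g1])
      also have "\<dots> = ennreal (exp (real (Suc n) * (- (a * ?h / 2))))"
        by (simp only: exp_of_nat_mult ennreal_power exp_ge_zero)
      also have "real (Suc n) * (- (a * ?h / 2)) = - (a * T / (2 * real (Suc m)))"
        by (simp add: h_def field_simps del: of_nat_Suc)
      finally show ?case .
    qed
  qed
  have f_lim: "(\<lambda>n. \<integral>\<^sup>+ \<omega>. f m n \<omega> \<partial>P x) \<longlonglongrightarrow> 0" for m
  proof (rule order_tendstoI)
    fix e :: ennreal assume "0 < e"
    then obtain d' where d': "0 < d'" "d' < e"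
      using dense by blast
    then obtain d where d: "0 < d" "ennreal d < e"
      by (cases d') auto
    \<comment> \<open>Solves for the rate at which the bound in \<open>f_le\<close> equals
      \<open>d\<close>; it is negative when \<open>d > 1\<close>, which \<open>incr\<close>
      permits.\<close>
    define a where "a = - ln d * (2 * real (Suc m)) / T"
    have "exp (- (a * T / (2 * real (Suc m)))) = d"
      using \<open>0 < T\<close> d by (simp add: a_def del: of_nat_Suc)
    then show "\<forall>\<^sub>F n in sequentially. (\<integral>\<^sup>+ \<omega>. f m n \<omega> \<partial>P x) < e"
      using f_le[of m a] d by (auto elim!: eventually_mono)
  qed simp
  \<comment> \<open>Fatou: the sums diverge at least along a subsequence of meshes depending on
    \<open>\<omega>\<close>.\<close>
  have "AE \<omega> in P x. liminf (\<lambda>n. f m n \<omega>) = 0" for m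
  proof -
    have "(\<integral>\<^sup>+ \<omega>. liminf (\<lambda>n. f m n \<omega>) \<partial>P x) \<le> liminf (\<lambda>n. \<integral>\<^sup>+ \<omega>. f m n \<omega> \<partial>P x)"
      by (rule nn_integral_liminf) measurable
    also have "\<dots> = 0"
      using lim_imp_Liminf[OF _ f_lim] by simp
    finally show ?thesis
      by (subst nn_integral_0_iff_AE[symmetric]) (auto simp: measurable)
  qed
  then have "AE \<omega> in P x. \<forall>m. liminf (\<lambda>n. f m n \<omega>) = 0"
    by (simp add: AE_all_countable)
  moreover have "AE \<omega> in P x. X 0 \<omega> = x"
  proof -
    have [measurable]: "X 0 \<in> borel_measurable (P x)"
      using measurable_X[of 0] by simp
    show ?thesis
      using start by (subst P.prob_eq_1[symmetric] P.prob_Collect_eq_1[symmetric]) (auto simp: space_P)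
  qed
  ultimately show ?thesis
    using AE_space
  proof eventually_elim
    case (elim \<omega>)
    have "cadlag (\<lambda>t. X t \<omega>)"
      using elim by (intro cadlag_paths) (simp add: space_P)
    then have "((\<lambda>t. X t \<omega>) \<longlongrightarrow> x) (at_right 0)"
      using elim by (force simp: cadlag_def)
    then have "\<forall>\<^sub>F t in at_right 0. X t \<omega> \<in> ball x r"
      by (rule topological_tendstoD) (use \<open>0 < r\<close> in auto)
    then obtain b where b: "0 < b" "\<And>t. 0 < t \<Longrightarrow> t < b \<Longrightarrow> X t \<omega> \<in> ball x r"
      by (auto simp: eventually_at_right_field)
    have in_ball: "X t \<omega> \<in> cball x r" if "0 \<le> t" "t < b" for t
      using b(2)[of t] that elim \<open>0 < r\<close> by (cases "t = 0") (auto simp: less_imp_le)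
    \<comment> \<open>The length \<open>b\<close> is random, so \<open>m\<close> depends on
      \<open>\<omega>\<close>; the exceptional null sets were therefore collected over all
      \<open>m\<close> beforehand.\<close>
    obtain m where m: "T / real (Suc m) < b"
      using reals_Archimedean[of "b / T"] b(1) \<open>0 < T\<close> by (auto simp: field_simps simp del: of_nat_Suc)
    show ?case
    proof (rule ccontr)
      assume "p_variation lam (\<lambda>t. X t \<omega>) 0 T \<noteq> \<top>"
      then obtain v where v: "0 \<le> v" "p_variation lam (\<lambda>t. X t \<omega>) 0 T = ennreal v"
        by (cases "p_variation lam (\<lambda>t. X t \<omega>) 0 T") auto
      \<comment> \<open>No factor is killed on this interval, so a finite variation \<open>v\<close>
        bounds every sum in the exponent and keeps the products away from \<open>0\<close>.\<close>
      have "ennreal (exp (- v)) \<le> f m n \<omega>" for n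
      proof -
        let ?h = "h m n"
        let ?X = "\<lambda>j. X (real j * ?h) \<omega>"
        have "X (real j * ?h) \<omega> \<in> cball x r" if "j < Suc n" for j
        proof (rule in_ball)
          have "real j * ?h \<le> real (Suc n) * ?h"
            using that h[of m n] by (intro mult_right_mono) auto
          also have "\<dots> = T / real (Suc m)"
            by (simp add: h_def del: of_nat_Suc)
          finally show "real j * ?h < b"
            using m by simp
        qed (use h[of m n] in auto)
        then have "f m n \<omega> = (\<Prod>j<Suc n. ennreal (exp (- Y (?X j) (?X (Suc j)))))"
          unfolding f_def g_def by (intro prod.cong) auto
        also have "\<dots> = ennreal (exp (- (\<Sum>j<Suc n. Y (?X j) (?X (Suc j)))))"
          by (simp only: prod_ennreal[OF exp_ge_zero] sum_negf[symmetric] exp_sum[OF finite_lessThan])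
        finally have f_eq: "f m n \<omega> = ennreal (exp (- (\<Sum>j<Suc n. Y (?X j) (?X (Suc j)))))" .
        have "ennreal (\<Sum>j<Suc n. Y (?X j) (?X (Suc j))) = (\<Sum>j<Suc n. ennreal (Y (?X j) (?X (Suc j))))"
          by (rule sum_ennreal[symmetric]) (rule Y01)
        also have "\<dots> \<le> (\<Sum>j<Suc n. ennreal (norm (?X (Suc j) - ?X j) powr lam))"
          using \<open>0 < lam\<close> unfolding Y_def by (intro sum_mono ennreal_leI powr_mono2) auto
        also have "\<dots> \<le> p_variation lam (\<lambda>t. X t \<omega>) 0 T"
        proof (rule p_variation_ge_uniform_sum[OF h])
          show "T = real (Suc m * Suc n) * ?h"
            by (simp add: h_def del: of_nat_Suc mult_Suc mult_Suc_right)
        qed simp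
        finally have "(\<Sum>j<Suc n. Y (?X j) (?X (Suc j))) \<le> v"
          using v by (simp only: ennreal_le_iff)
        then show ?thesis
          unfolding f_eq by (intro ennreal_leI) simp
      qed
      then have "ennreal (exp (- v)) \<le> liminf (\<lambda>n. f m n \<omega>)"
        by (intro Liminf_bounded) auto
      then show False
        using elim by (simp add: ennreal_eq_0_iff not_le)
    qed
  qed
qed

end

theorem theorem2p18:
  fixes M :: "'w measure" and F :: "real \<Rightarrow> 'w measure"
    and X :: "real \<Rightarrow> 'w \<Rightarrow> real ^ 'd" and P :: "real ^ 'd \<Rightarrow> 'w measure"
    and \<kappa> :: "real ^ 'd \<Rightarrow> real"
    and \<l> :: "real ^ 'd \<Rightarrow> real ^ 'd" and Q :: "real ^ 'd \<Rightarrow> real ^ 'd ^ 'd"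
    and N :: "real ^ 'd \<Rightarrow> (real ^ 'd) measure"
    and q :: "real ^ 'd \<Rightarrow> real ^ 'd \<Rightarrow> complex"
    and x :: "real ^ 'd" and \<delta>' R' lam T :: real
  assumes "levy_type_process M F X P \<kappa> \<l> Q N"
    and "normal_process M X P"
    and "locally_bounded \<l>" and "locally_bounded Q" and "locally_bounded (jump_intensity N)"
    and "finely_continuous X P \<l>" and "finely_continuous X P Q"
    and "finely_continuous X P (jump_intensity N)"
    and "has_symbol X P q"
    and "0 < \<delta>'" and "0 < R'" and "condition_A X P q x \<delta>' R'"
    and "0 < local_index q x" and "0 < lam" and "ereal lam < local_index q x"
    and "0 < T"
  shows "AE \<omega> in P x. p_variation lam (\<lambda>t. X t \<omega>) 0 T = \<top>"
proof -
  interpret levy_type_process M F X P \<kappa> \<l> Q N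
    by fact
  obtain R where R: "0 < R" and lam_less: "ereal lam < (INF y \<in> cball x R. spot_index q y)"
    using \<open>ereal lam < local_index q x\<close> by (auto simp: local_index_def less_SUP_iff)
  \<comment> \<open>The gap between \<open>lam\<close> and \<open>c\<close> turns the missing decay
    at exponent \<open>c\<close> into growth of \<open>Re q\<close> beyond every multiple of
    \<open>norm \<xi> powr lam\<close>.\<close>
  then obtain c where c: "lam < c" "ereal c < (INF y \<in> cball x R. spot_index q y)"
    using ereal_dense2[of "ereal lam"] by auto
  have "ereal lam < ereal 2"
    by (rule less_le_trans[OF \<open>ereal lam < local_index q x\<close>])
       (use local_index_le_2[OF \<open>has_symbol X P q\<close> \<open>condition_A X P q x \<delta>' R'\<close> \<open>0 < R'\<close> \<open>0 < \<delta>'\<close>] in simp)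
  then have "lam \<le> 2"
    by simp
  show ?thesis
  proof (rule AE_p_variation_eq_top)
    \<comment> \<open>The radius must respect both the ball where the spot index exceeds
      \<open>c\<close> and the ball of Condition (A).\<close>
    show "0 < min R \<delta>'"
      using R \<open>0 < \<delta>'\<close> by simp
    show "measure (P x) {\<omega> \<in> space M. X 0 \<omega> = x} = 1"
      using \<open>normal_process M X P\<close> by (simp add: normal_process_def)
    show "\<exists>h0>0. \<forall>h y. 0 < h \<longrightarrow> h < h0 \<longrightarrow> y \<in> cball x (min R \<delta>') \<longrightarrow>
      a * h \<le> (\<integral>\<omega>. min 1 (norm (X h \<omega> - y)) powr lam \<partial>P y)" for a
    proof (rule truncated_increment_lower_bound[OF \<open>has_symbol X P q\<close> \<open>condition_A X P q x \<delta>' R'\<close> \<open>0 < R'\<close> \<open>0 < lam\<close> \<open>lam \<le> 2\<close> c(1)])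
      fix y assume "y \<in> cball x (min R \<delta>')"
      then have "ereal c < spot_index q y"
        by (intro less_le_trans[OF c(2)] INF_lower) simp
      show "\<not> ((\<lambda>\<xi>. norm \<xi> powr (- c) * Re (q y \<xi>)) \<longlongrightarrow> 0) at_infinity"
      proof
        assume "((\<lambda>\<xi>. norm \<xi> powr (- c) * Re (q y \<xi>)) \<longlongrightarrow> 0) at_infinity"
        then have "spot_index q y \<le> ereal c"
          unfolding spot_index_def using c(1) \<open>0 < lam\<close> by (intro INF_lower) auto
        then show False
          using \<open>ereal c < spot_index q y\<close> by simp
      qed
    qed simp
  qed fact+
qed

end
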